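(* If an input-output function $\mathfrak{F}:\mathcal{U}\times\mathcal{P}\to\mathcal{Y}$ has an impulse response representation (IIR), then the function $\theta_{\mathfrak{F}}$ is uniquely determined by $\mathfrak{F}$; i.e., if $\hat{\mathfrak{F}}:\mathcal{U}\times\mathcal{P}\to\mathcal{Y}$ is another input-output function which admits an IIR, then $$\mathfrak{F}=\hat{\mathfrak{F}}\iff\theta_{\mathfrak{F}}=\theta_{\hat{\mathfrak{F}}}.$$ Moreover, there exists a unique extension $\mathfrak{F}_\mathrm{e}$ of $\mathfrak{F}$ to $\mathcal{U}\times\mathcal{P}_\mathrm{e}$, where $\mathcal{P}_\mathrm{e}$ is the set of all piecewise-continuous functions $[0,\infty)\to\mathbb{R}^{n_\mathrm{p}}$ in CT, or $\mathcal{P}_\mathrm{e}=(\mathbb{R}^{n_\mathrm{p}})^{\mathbb{N}}$ in DT. The extension $\mathfrak{F}_\mathrm{e}$ also admits an IIR and $\theta_{\mathfrak{F}}=\theta_{\mathfrak{F}_\mathrm{e}}$.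
   Context: Time is either continuous (CT: $\mathbb{T}=[0,\infty)$) or discrete (DT: $\mathbb{T}=\mathbb{N}=\{0,1,\ldots\}$); the statement is asserted in each of the two cases. The scheduling set $\mathbb{P}\subseteq\mathbb{R}^{n_\mathrm{p}}$ is fixed and its affine hull is $\mathbb{R}^{n_\mathrm{p}}$; $n_\mathrm{u},n_\mathrm{y}$ are fixed. In CT, $\mathcal{U},\mathcal{P},\mathcal{Y}$ are the sets of piecewise-continuous functions from $[0,\infty)$ to $\mathbb{R}^{n_\mathrm{u}}$, $\mathbb{P}$, $\mathbb{R}^{n_\mathrm{y}}$ respectively (finitely many discontinuities on each compact interval, with finite one-sided limits there); in DT they are the sets of all functions from $\mathbb{N}$ to these sets. Let $\mathbb{I}_0^{n_\mathrm{p}}=\{0,\ldots,n_\mathrm{p}\}$ and let $\mathcal{S}(\mathbb{I}_0^{n_\mathrm{p}})$ be the set of finite sequences over it, including the empty sequence $\epsilon$; $|s|$ is the length of $s$. Write $p_0(t)=1$ and $p_i(t)$ for the $i$th component of $p(t)$. For $s\in\mathcal{S}(\mathbb{I}_0^{n_\mathrm{p}})$ and $\tau\le t$: in CT, $(w_\epsilon\diamond p)(t,\tau)=1$ and $(w_{s_1\cdots s_n}\diamond p)(t,\tau)=\int_\tau^t p_{s_n}(\delta)(w_{s_1\cdots s_{n-1}}\diamond p)(\delta,\tau)\,d\delta$; in DT, $(w_{s_1\cdots s_n}\diamond p)(t,\tau)=p_{s_1}(\tau)p_{s_2}(\tau+1)\cdots p_{s_n}(t)$ if $n=t-\tau+1$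 and $0$ otherwise (for $t=\tau-1$: value $1$ for $s=\epsilon$ and $0$ otherwise). Let $\mathcal{Q}$ be $\mathcal{P}$ or $\mathcal{P}_\mathrm{e}$. A function $\mathfrak{F}:\mathcal{U}\times\mathcal{Q}\to\mathcal{Y}$ has (admits) an IIR if there is a function $\theta_{\mathfrak{F}}:\mathcal{S}(\mathbb{I}_0^{n_\mathrm{p}})\to\mathbb{R}^{(n_\mathrm{p}+1)n_\mathrm{y}\times(n_\mathrm{u}(n_\mathrm{p}+1)+1)}$, whose $i$th block row ($i=0,\ldots,n_\mathrm{p}$) is $[\eta_{i,\mathfrak{F}}(s)\ \theta_{i,0,\mathfrak{F}}(s)\ \cdots\ \theta_{i,n_\mathrm{p},\mathfrak{F}}(s)]$ with $\eta_{i,\mathfrak{F}}(s)\in\mathbb{R}^{n_\mathrm{y}}$, $\theta_{i,j,\mathfrak{F}}(s)\in\mathbb{R}^{n_\mathrm{y}\times n_\mathrm{u}}$, such that (1) there are $K,R>0$ with $\|\theta_{\mathfrak{F}}(s)\|_F\le KR^{|s|}$ for all $s$ (Frobenius norm); (2) for all $(u,p)\in\mathcal{U}\times\mathcal{Q}$, $t\in\mathbb{T}$: in CT, $\mathfrak{F}(u,p)(t)=(g\diamond p)(t)+\int_0^t(h\diamond p)(\delta,t)u(\delta)\,d\delta$ with $(g\diamond p)(t)=\sum_{i}\sum_{s}p_i(t)\eta_{i,\mathfrak{F}}(s)(w_s\diamond p)(t,0)$ and $(h\diamond p)(\delta,t)=\sum_{i,j}\sum_s\theta_{i,j,\mathfrak{F}}(s)p_i(t)p_j(\delta)(w_s\diamond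 p)(t,\delta)$; in DT, $\mathfrak{F}(u,p)(t)=(g\diamond p)(t)+\sum_{\delta=0}^{t-1}(h\diamond p)(\delta,t)u(\delta)$ with $(g\diamond p)(t)=\sum_{i,s}\eta_{i,\mathfrak{F}}(s)p_i(t)(w_s\diamond p)(t-1,0)$ and $(h\diamond p)(\delta,t)=\sum_{i,j,s}\theta_{i,j,\mathfrak{F}}(s)p_i(t)p_j(\delta)(w_s\diamond p)(t-1,\delta+1)$; here $i,j$ range over $\mathbb{I}_0^{n_\mathrm{p}}$ and $s$ over $\mathcal{S}(\mathbb{I}_0^{n_\mathrm{p}})$.
   Formalization: The extension is proved unique among extensions that admit an IIR; among all functions on U×P_e extending F uniqueness fails when P is not the whole space, since values at p outside P can be chosen arbitrarily. *)

theory Defs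
  imports "HOL-Analysis.Analysis"
begin

text \<open>
  The index set \<open>{0,\<dots>,n\<^sub>p}\<close> is the type \<open>'p option\<close>: \<open>None\<close> is the index 0 and \<open>Some i\<close> are
  the indices of the components of \<open>real ^ 'p\<close>. Finite sequences over it are lists.
\<close>

definition aug :: "('t \<Rightarrow> real ^ 'p) \<Rightarrow> 't \<Rightarrow> 'p option \<Rightarrow> real" where
  "aug p t i = (case i of None \<Rightarrow> 1 | Some k \<Rightarrow> p t $ k)"

text \<open>
  Matrices with \<open>(n\<^sub>p + 1) n\<^sub>y\<close> rows and \<open>1 + (n\<^sub>p + 1) n\<^sub>u\<close> columns. Row \<open>(i, a)\<close> is row \<open>a\<close> of
  block row \<open>i\<close>; column \<open>Inl ()\<close> is the leading column, column \<open>Inr (j, b)\<close> is column \<open>b\<close> of the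
  block with index \<open>j\<close>. The norm of this type is the Frobenius norm (\<open>norm_iir_matrix\<close> below).
\<close>

type_synonym ('p, 'u, 'y) iir_matrix =
  "real ^ (unit + 'p option \<times> 'u) ^ ('p option \<times> 'y)"

lemma norm_iir_matrix:
  fixes M :: "('p::finite, 'u::finite, 'y::finite) iir_matrix"
  shows "norm M = sqrt (\<Sum>r\<in>UNIV. \<Sum>c\<in>UNIV. (M $ r $ c)\<^sup>2)"
  by (simp add: norm_vec_def L2_set_def sum_nonneg)

definition eta ::
  "('p option list \<Rightarrow> ('p::finite, 'u::finite, 'y::finite) iir_matrix)
    \<Rightarrow> 'p option \<Rightarrow> 'p option list \<Rightarrow> real ^ 'y" where
  "eta \<theta> i s = (\<chi> a. \<theta> s $ (i, a) $ Inl ())"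

definition theta ::
  "('p option list \<Rightarrow> ('p::finite, 'u::finite, 'y::finite) iir_matrix)
    \<Rightarrow> 'p option \<Rightarrow> 'p option \<Rightarrow> 'p option list \<Rightarrow> real ^ 'u ^ 'y" where
  "theta \<theta> i j s = (\<chi> a b. \<theta> s $ (i, a) $ Inr (j, b))"

definition exp_bounded ::
  "('p option list \<Rightarrow> ('p::finite, 'u::finite, 'y::finite) iir_matrix) \<Rightarrow> bool" where
  "exp_bounded \<theta> \<longleftrightarrow> (\<exists>K R. K > 0 \<and> R > 0 \<and> (\<forall>s. norm (\<theta> s) \<le> K * R ^ length s))"

text \<open>
  Functions on \<open>[0,\<infinity>)\<close> are functions on the reals that are extensional outside \<open>{0..}\<close>, and
  input-output functions are extensional outside their domain, so that HOL equality is equality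
  of functions on the intended domain.
\<close>

definition piecewise_cont :: "(real \<Rightarrow> 'a::topological_space) \<Rightarrow> bool" where
  "piecewise_cont f \<longleftrightarrow>
    (\<forall>a b. finite {t \<in> {a..b} \<inter> {0..}. \<not> continuous (at t within {0..}) f}) \<and>
    (\<forall>t\<ge>0. \<not> continuous (at t within {0..}) f \<longrightarrow>
      (\<exists>l. (f \<longlongrightarrow> l) (at_right t)) \<and> (t > 0 \<longrightarrow> (\<exists>l. (f \<longlongrightarrow> l) (at_left t))))"

definition ct_signals :: "'a::topological_space set \<Rightarrow> (real \<Rightarrow> 'a) set" where
  "ct_signals X = {f \<in> {0..} \<rightarrow>\<^sub>E X. piecewise_cont f}"

definition ct_dom ::
  "(real ^ 'p) set \<Rightarrow> ((real \<Rightarrow> real ^ 'u) \<times> (real \<Rightarrow> real ^ 'p)) set" where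
  "ct_dom Q = ct_signals UNIV \<times> ct_signals Q"

definition ct_io ::
  "(real ^ 'p) set
    \<Rightarrow> ((real \<Rightarrow> real ^ 'u) \<times> (real \<Rightarrow> real ^ 'p) \<Rightarrow> real \<Rightarrow> real ^ 'y) set" where
  "ct_io Q = ct_dom Q \<rightarrow>\<^sub>E ct_signals UNIV"

fun ct_w :: "(real \<Rightarrow> real ^ 'p) \<Rightarrow> 'p option list \<Rightarrow> real \<Rightarrow> real \<Rightarrow> real" where
  "ct_w p s t \<tau> =
    (if s = [] then 1
     else integral {\<tau>..t} (\<lambda>\<delta>. aug p \<delta> (last s) * ct_w p (butlast s) \<delta> \<tau>))"

declare ct_w.simps [simp del]

lemma ct_w_Nil: "ct_w p [] t \<tau> = 1"
  by (simp add: ct_w.simps)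

lemma ct_w_snoc: "ct_w p (s @ [i]) t \<tau> = integral {\<tau>..t} (\<lambda>\<delta>. aug p \<delta> i * ct_w p s \<delta> \<tau>)"
  by (subst ct_w.simps) simp

definition ct_g ::
  "('p option list \<Rightarrow> ('p::finite, 'u::finite, 'y::finite) iir_matrix)
    \<Rightarrow> (real \<Rightarrow> real ^ 'p) \<Rightarrow> real \<Rightarrow> real ^ 'y" where
  "ct_g \<theta> p t = (\<Sum>i\<in>UNIV. \<Sum>\<^sub>\<infinity>s. (aug p t i * ct_w p s t 0) *\<^sub>R eta \<theta> i s)"

definition ct_h ::
  "('p option list \<Rightarrow> ('p::finite, 'u::finite, 'y::finite) iir_matrix)
    \<Rightarrow> (real \<Rightarrow> real ^ 'p) \<Rightarrow> real \<Rightarrow> real \<Rightarrow> real ^ 'u ^ 'y" where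
  "ct_h \<theta> p \<delta> t =
    (\<Sum>i\<in>UNIV. \<Sum>j\<in>UNIV. \<Sum>\<^sub>\<infinity>s. (aug p t i * aug p \<delta> j * ct_w p s t \<delta>) *\<^sub>R theta \<theta> i j s)"

definition ct_iir ::
  "(real ^ 'p) set
    \<Rightarrow> ((real \<Rightarrow> real ^ 'u) \<times> (real \<Rightarrow> real ^ 'p) \<Rightarrow> real \<Rightarrow> real ^ 'y)
    \<Rightarrow> ('p option list \<Rightarrow> ('p::finite, 'u::finite, 'y::finite) iir_matrix) \<Rightarrow> bool" where
  "ct_iir Q F \<theta> \<longleftrightarrow> exp_bounded \<theta> \<and>
    (\<forall>(u, p) \<in> ct_dom Q. \<forall>t\<ge>0.
      F (u, p) t = ct_g \<theta> p t + integral {0..t} (\<lambda>\<delta>. ct_h \<theta> p \<delta> t *v u \<delta>))"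

definition dt_signals :: "'a set \<Rightarrow> (nat \<Rightarrow> 'a) set" where
  "dt_signals X = (UNIV \<rightarrow> X)"

definition dt_dom ::
  "(real ^ 'p) set \<Rightarrow> ((nat \<Rightarrow> real ^ 'u) \<times> (nat \<Rightarrow> real ^ 'p)) set" where
  "dt_dom Q = dt_signals UNIV \<times> dt_signals Q"

definition dt_io ::
  "(real ^ 'p) set
    \<Rightarrow> ((nat \<Rightarrow> real ^ 'u) \<times> (nat \<Rightarrow> real ^ 'p) \<Rightarrow> nat \<Rightarrow> real ^ 'y) set" where
  "dt_io Q = dt_dom Q \<rightarrow>\<^sub>E dt_signals UNIV"

text \<open>
  The time arguments are integers since \<open>t = \<tau> - 1\<close> with \<open>\<tau> = 0\<close> occurs; only \<open>\<tau> \<ge> 0\<close> is used.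
\<close>

definition dt_w :: "(nat \<Rightarrow> real ^ 'p) \<Rightarrow> 'p option list \<Rightarrow> int \<Rightarrow> int \<Rightarrow> real" where
  "dt_w p s t \<tau> =
    (if int (length s) = t - \<tau> + 1 then \<Prod>k<length s. aug p (nat (\<tau> + int k)) (s ! k) else 0)"

definition dt_g ::
  "('p option list \<Rightarrow> ('p::finite, 'u::finite, 'y::finite) iir_matrix)
    \<Rightarrow> (nat \<Rightarrow> real ^ 'p) \<Rightarrow> nat \<Rightarrow> real ^ 'y" where
  "dt_g \<theta> p t = (\<Sum>i\<in>UNIV. \<Sum>\<^sub>\<infinity>s. (aug p t i * dt_w p s (int t - 1) 0) *\<^sub>R eta \<theta> i s)"

definition dt_h ::
  "('p option list \<Rightarrow> ('p::finite, 'u::finite, 'y::finite) iir_matrix)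
    \<Rightarrow> (nat \<Rightarrow> real ^ 'p) \<Rightarrow> nat \<Rightarrow> nat \<Rightarrow> real ^ 'u ^ 'y" where
  "dt_h \<theta> p \<delta> t =
    (\<Sum>i\<in>UNIV. \<Sum>j\<in>UNIV. \<Sum>\<^sub>\<infinity>s.
      (aug p t i * aug p \<delta> j * dt_w p s (int t - 1) (int \<delta> + 1)) *\<^sub>R theta \<theta> i j s)"

definition dt_iir ::
  "(real ^ 'p) set
    \<Rightarrow> ((nat \<Rightarrow> real ^ 'u) \<times> (nat \<Rightarrow> real ^ 'p) \<Rightarrow> nat \<Rightarrow> real ^ 'y)
    \<Rightarrow> ('p option list \<Rightarrow> ('p::finite, 'u::finite, 'y::finite) iir_matrix) \<Rightarrow> bool" where
  "dt_iir Q F \<theta> \<longleftrightarrow> exp_bounded \<theta> \<and>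
    (\<forall>(u, p) \<in> dt_dom Q. \<forall>t.
      F (u, p) t = dt_g \<theta> p t + (\<Sum>\<delta><t. dt_h \<theta> p \<delta> t *v u \<delta>))"

end

theory Submission imports Defs
begin

text \<open>
  Changing \<open>p\<close> at (in continuous time: from) the current time \<open>t\<close> does not affect the iterated
  integrals or products over the past, so, the affine hull of \<open>P\<close> being the whole space, the
  factors of the \<open>p\<^sub>i(t)\<close> in a vanishing output vanish separately. In continuous time this applies
  again after differentiating a vanishing series
  \<open>\<Sum>\<^sub>s c(s) (w\<^sub>s \<diamond> p)(t, \<tau>)\<close> in \<open>t\<close>: for each \<open>i\<close> the series with coefficients
  \<open>c(s i)\<close> vanishes as well, and letters are stripped from the end of \<open>s\<close> until
  \<open>t = \<tau>\<close> isolates \<open>c(\<epsilon>)\<close>. The zero input gives the \<open>\<eta>\<close> coefficients (\<open>\<tau> = 0\<close>); inputs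
  \<open>u = e\<^sub>b\<close> on \<open>[0, r)\<close> with \<open>r \<le> 1\<close> and \<open>p\<close> constant on \<open>[0, 1)\<close> isolate the kernel at
  \<open>\<delta> = 1\<close>, hence the other coefficients (\<open>\<tau> = 1\<close>). Since the series converge for every
  piecewise continuous \<open>p\<close>, the same \<open>\<theta>\<close> defines the extension.
\<close>

section \<open>Piecewise continuous signals\<close>

text \<open>Nothing but its affine hull is known of \<open>P\<close>, which may be a finite set of
  points. So p cannot be perturbed continuously, and every test signal is a splice of signals with
  values in \<open>P\<close>. A signal that jumps would spoil the derivative of an indefinite
  integral; p is therefore held at a constant x from the time in question on, which makes the
  integrand continuous there, and a one-sided derivative is enough. The kernel is isolated at
  \<delta> = 1 and not at \<delta> = 0 because p(\<delta>) has to vary independently of p on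
  [\<delta>, t]: the interval before \<delta> supplies this freedom, and continuity of the series in
  its start time carries the information over to \<delta>. Continuity is thus used in both time
  arguments and is proved jointly, from estimates uniform over bounded times. In discrete time words
  are stripped from the front, by changing p at the earliest time. Uniqueness of the extension is
  meant among functions that admit an IIR: the restriction to the original domain shows that any
  such extension has the same \<theta>, and \<theta> determines the function.\<close>

lemma piecewise_cont_at_right:
  assumes "piecewise_cont f" "t \<ge> 0"
  shows "\<exists>l. (f \<longlongrightarrow> l) (at_right t)"
proof (cases "continuous (at t within {0..}) f")
  case True
  then have "(f \<longlongrightarrow> f t) (at t within {0..})"
    by (simp add: continuous_within)
  then have "(f \<longlongrightarrow> f t) (at t within {t<..})"
    by (rule tendsto_within_subset) (use assms in auto)
  then show ?thesis by blast
qed (use assms in \<open>auto simp: piecewise_cont_def\<close>)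

lemma piecewise_cont_at_left:
  assumes "piecewise_cont f" "t > 0"
  shows "\<exists>l. (f \<longlongrightarrow> l) (at_left t)"
proof (cases "continuous (at t within {0..}) f")
  case True
  then have "(f \<longlongrightarrow> f t) (at t within {0..})"
    by (simp add: continuous_within)
  then have "(f \<longlongrightarrow> f t) (at t within {0<..<t})"
    by (rule tendsto_within_subset) auto
  moreover have "at t within {0<..<t} = at t within {..<t}"
    by (rule at_within_nhd[where S="{0<..}"]) (use assms in auto)
  ultimately show ?thesis by auto
qed (use assms in \<open>auto simp: piecewise_cont_def\<close>)

text \<open>One-sided limits are asked for at every time, the form in which
  \<open>piecewise_cont_at_right\<close> and \<open>piecewise_cont_at_left\<close> supply them, so
  closure proofs need no case split on whether their arguments are continuous.\<close>

lemma piecewise_contI: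
  assumes "\<And>T. finite {t \<in> {0..T}. \<not> continuous (at t within {0..}) f}"
    and "\<And>t. t \<ge> 0 \<Longrightarrow> \<exists>l. (f \<longlongrightarrow> l) (at_right t)"
    and "\<And>t. t > 0 \<Longrightarrow> \<exists>l. (f \<longlongrightarrow> l) (at_left t)"
  shows "piecewise_cont f"
  unfolding piecewise_cont_def
proof (intro conjI allI impI)
  fix a b :: real
  show "finite {t \<in> {a..b} \<inter> {0..}. \<not> continuous (at t within {0..}) f}"
    by (rule finite_subset[OF _ assms(1)[of b]]) auto
qed (use assms in auto)

lemma piecewise_cont_finite:
  assumes "piecewise_cont f"
  shows "finite {t \<in> {0..T}. \<not> continuous (at t within {0..}) f}"
proof -
  have "finite {t \<in> {0..T} \<inter> {0..}. \<not> continuous (at t within {0..}) f}"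
    using assms unfolding piecewise_cont_def by blast
  then show ?thesis by (rule rev_finite_subset) auto
qed

lemma continuous_on_imp_piecewise_cont:
  assumes "continuous_on {0..} f"
  shows "piecewise_cont f"
proof -
  have "continuous (at t within {0..}) f" if "t \<ge> 0" for t
    using assms that by (auto simp: continuous_on_eq_continuous_within)
  then have "{t \<in> {a..b} \<inter> {0..}. \<not> continuous (at t within {0..}) f} = {}" for a b
    by auto
  then show ?thesis
    using assms unfolding piecewise_cont_def continuous_on_eq_continuous_within
    by (metis atLeast_iff finite.emptyI)
qed

lemma at_within_atLeast_cong:
  fixes f g :: "real \<Rightarrow> 'a::topological_space"
  assumes "\<And>x. x \<ge> 0 \<Longrightarrow> f x = g x" "t \<ge> 0"
  shows "continuous (at t within {0..}) f = continuous (at t within {0..}) g"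
    and "(f \<longlongrightarrow> l) (at_right t) = (g \<longlongrightarrow> l) (at_right t)"
    and "t > 0 \<Longrightarrow> (f \<longlongrightarrow> l) (at_left t) = (g \<longlongrightarrow> l) (at_left t)"
proof -
  have "\<forall>\<^sub>F x in at t within {0..}. f x = g x"
    using assms by (auto simp: eventually_at_filter)
  then show "continuous (at t within {0..}) f = continuous (at t within {0..}) g"
    using assms by (auto simp: continuous_within intro!: tendsto_cong)
  have "\<forall>\<^sub>F x in at_right t. f x = g x"
    using assms by (auto simp: eventually_at_filter)
  then show "(f \<longlongrightarrow> l) (at_right t) = (g \<longlongrightarrow> l) (at_right t)"
    by (rule tendsto_cong)
  assume "t > 0"
  then have "\<forall>\<^sub>F x in at_left t. 0 < x"
    using eventually_at_left_real[of 0 t] by (simp add: eventually_mono)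
  then have "\<forall>\<^sub>F x in at_left t. f x = g x"
    by eventually_elim (use assms in auto)
  then show "(f \<longlongrightarrow> l) (at_left t) = (g \<longlongrightarrow> l) (at_left t)"
    by (rule tendsto_cong)
qed

lemma piecewise_cont_cong:
  assumes "piecewise_cont f" "\<And>x. x \<ge> 0 \<Longrightarrow> f x = g x"
  shows "piecewise_cont g"
proof (rule piecewise_contI)
  fix T :: real
  show "finite {t \<in> {0..T}. \<not> continuous (at t within {0..}) g}"
    by (rule finite_subset[OF _ piecewise_cont_finite[OF assms(1), of T]])
       (use at_within_atLeast_cong(1)[of f g, OF assms(2)] in auto)
next
  fix t :: real assume "t \<ge> 0"
  then show "\<exists>l. (g \<longlongrightarrow> l) (at_right t)"
    using piecewise_cont_at_right[OF assms(1)] at_within_atLeast_cong(2)[of f g, OF assms(2)] by blast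
next
  fix t :: real assume "t > 0"
  then show "\<exists>l. (g \<longlongrightarrow> l) (at_left t)"
    using piecewise_cont_at_left[OF assms(1)] at_within_atLeast_cong(3)[of f g, OF assms(2)]
    by (metis less_eq_real_def)
qed

lemma piecewise_cont_compose:
  fixes f :: "real \<Rightarrow> 'a::t2_space" and g :: "'a \<Rightarrow> 'b::topological_space"
  assumes "piecewise_cont f" "continuous_on UNIV g"
  shows "piecewise_cont (\<lambda>t. g (f t))"
proof (rule piecewise_contI)
  have g: "isCont g x" for x
    using assms(2) by (simp add: continuous_on_eq_continuous_at)
  fix T :: real
  show "finite {t \<in> {0..T}. \<not> continuous (at t within {0..}) (\<lambda>t. g (f t))}"
    by (rule finite_subset[OF _ piecewise_cont_finite[OF assms(1), of T]])
       (auto intro: continuous_within_compose3[OF g])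
next
  have g: "isCont g x" for x
    using assms(2) by (simp add: continuous_on_eq_continuous_at)
  fix t :: real
  show "\<exists>l. ((\<lambda>t. g (f t)) \<longlongrightarrow> l) (at_right t)" if "t \<ge> 0"
    using piecewise_cont_at_right[OF assms(1) that] isCont_tendsto_compose[OF g] by blast
  show "\<exists>l. ((\<lambda>t. g (f t)) \<longlongrightarrow> l) (at_left t)" if "t > 0"
    using piecewise_cont_at_left[OF assms(1) that] isCont_tendsto_compose[OF g] by blast
qed

lemma piecewise_cont_Pair:
  assumes "piecewise_cont f" "piecewise_cont g"
  shows "piecewise_cont (\<lambda>t. (f t, g t))"
proof (rule piecewise_contI)
  fix T :: real
  show "finite {t \<in> {0..T}. \<not> continuous (at t within {0..}) (\<lambda>t. (f t, g t))}"
    by (rule finite_subset[OF _ finite_UnI[OF piecewise_cont_finite[OF assms(1), of T]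
          piecewise_cont_finite[OF assms(2), of T]]])
       (auto intro: continuous_Pair)
next
  fix t :: real
  show "\<exists>l. ((\<lambda>t. (f t, g t)) \<longlongrightarrow> l) (at_right t)" if "t \<ge> 0"
    using assms[THEN piecewise_cont_at_right, OF that] by (blast intro: tendsto_Pair)
  show "\<exists>l. ((\<lambda>t. (f t, g t)) \<longlongrightarrow> l) (at_left t)" if "t > 0"
    using assms[THEN piecewise_cont_at_left, OF that] by (blast intro: tendsto_Pair)
qed

lemma piecewise_cont_const: "piecewise_cont (\<lambda>_. c)"
  by (rule continuous_on_imp_piecewise_cont) simp

lemma piecewise_cont_add:
  fixes f g :: "real \<Rightarrow> 'a::real_normed_vector"
  assumes "piecewise_cont f" "piecewise_cont g"
  shows "piecewise_cont (\<lambda>t. f t + g t)"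
proof -
  have "continuous_on UNIV (\<lambda>x::'a \<times> 'a. fst x + snd x)" by (intro continuous_intros)
  from piecewise_cont_compose[OF piecewise_cont_Pair[OF assms] this] show ?thesis by simp
qed

lemma piecewise_cont_mult:
  fixes f g :: "real \<Rightarrow> real"
  assumes "piecewise_cont f" "piecewise_cont g"
  shows "piecewise_cont (\<lambda>t. f t * g t)"
proof -
  have "continuous_on UNIV (\<lambda>x::real \<times> real. fst x * snd x)" by (intro continuous_intros)
  from piecewise_cont_compose[OF piecewise_cont_Pair[OF assms] this] show ?thesis by simp
qed

lemma piecewise_cont_sum:
  fixes f :: "'i \<Rightarrow> real \<Rightarrow> 'a::real_normed_vector"
  assumes "\<And>i. i \<in> I \<Longrightarrow> piecewise_cont (f i)"
  shows "piecewise_cont (\<lambda>t. \<Sum>i\<in>I. f i t)"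
  using assms
  by (induction I rule: infinite_finite_induct) (auto intro: piecewise_cont_const piecewise_cont_add)

lemma piecewise_cont_vec_nth:
  fixes f :: "real \<Rightarrow> real ^ 'n"
  shows "piecewise_cont f \<Longrightarrow> piecewise_cont (\<lambda>t. f t $ k)"
  by (erule piecewise_cont_compose[where g="\<lambda>x. x $ k"]) (intro continuous_intros)

lemma piecewise_cont_vec_lambda:
  fixes f :: "real \<Rightarrow> real ^ 'n::finite"
  assumes "\<And>k. piecewise_cont (\<lambda>t. f t $ k)"
  shows "piecewise_cont f"
proof -
  have "piecewise_cont (\<lambda>t. \<Sum>k\<in>UNIV. (f t $ k) *\<^sub>R axis k (1::real))"
    by (intro piecewise_cont_sum piecewise_cont_compose[OF assms]) (auto intro: continuous_intros)
  then show ?thesis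
    by (rule piecewise_cont_cong) (simp add: vec_eq_iff axis_def if_distrib cong: if_cong)
qed

lemma piecewise_cont_aug:
  fixes p :: "real \<Rightarrow> real ^ 'p"
  shows "piecewise_cont p \<Longrightarrow> piecewise_cont (\<lambda>t. aug p t i)"
  by (cases i) (simp_all add: aug_def piecewise_cont_const piecewise_cont_vec_nth)

text \<open>Away from \<open>t0\<close> the spliced function coincides locally with \<open>p\<close>
  or with \<open>q\<close>; at \<open>t0\<close> the left limit comes from \<open>p\<close> and the
  right limit from \<open>q\<close>. Hence \<open>t0\<close> is the only new candidate for a
  discontinuity.\<close>

lemma piecewise_cont_splice:
  assumes p: "piecewise_cont p" and q: "piecewise_cont q"
  shows "piecewise_cont (\<lambda>t. if t < t0 then p t else q t)" (is "piecewise_cont ?r")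
proof (rule piecewise_contI)
  have lt: "\<forall>\<^sub>F x in nhds t. ?r x = p x" if "t < t0" for t
    by (rule eventually_mono[OF eventually_nhds_in_open[of "{..<t0}" t]]) (use that in auto)
  have gt: "\<forall>\<^sub>F x in nhds t. ?r x = q x" if "t > t0" for t
    by (rule eventually_mono[OF eventually_nhds_in_open[of "{t0<..}" t]]) (use that in auto)
  have tends: "(?r \<longlongrightarrow> l) (at t within S) = (p' \<longlongrightarrow> l) (at t within S)"
    if "\<forall>\<^sub>F x in nhds t. ?r x = p' x" for t S l p'
    by (rule tendsto_cong, unfold eventually_at_filter, rule eventually_mono[OF that]) simp
  have cont: "continuous (at t within S) ?r = continuous (at t within S) p'"
    if "\<forall>\<^sub>F x in nhds t. ?r x = p' x" for t S p'
    using tends[OF that] eventually_nhds_x_imp_x[OF that] by (simp add: continuous_within)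
  fix T :: real
  have "{t \<in> {0..T}. \<not> continuous (at t within {0..}) ?r} \<subseteq>
      {t \<in> {0..T}. \<not> continuous (at t within {0..}) p} \<union>
      {t \<in> {0..T}. \<not> continuous (at t within {0..}) q} \<union> {t0}"
  proof
    fix t assume "t \<in> {t \<in> {0..T}. \<not> continuous (at t within {0..}) ?r}"
    then show "t \<in> {t \<in> {0..T}. \<not> continuous (at t within {0..}) p} \<union>
      {t \<in> {0..T}. \<not> continuous (at t within {0..}) q} \<union> {t0}"
      by (cases t t0 rule: linorder_cases) (simp_all add: cont[OF lt] cont[OF gt])
  qed
  then show "finite {t \<in> {0..T}. \<not> continuous (at t within {0..}) ?r}"
    by (rule finite_subset) (use piecewise_cont_finite[OF p] piecewise_cont_finite[OF q] in auto)
  fix t :: real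
  show "\<exists>l. (?r \<longlongrightarrow> l) (at_right t)" if "t \<ge> 0"
  proof (cases "t < t0")
    case True
    then show ?thesis using piecewise_cont_at_right[OF p that] by (simp only: tends[OF lt])
  next
    case False
    then have "\<forall>\<^sub>F x in at_right t. ?r x = q x"
      by (auto simp: eventually_at_filter)
    then show ?thesis
      using piecewise_cont_at_right[OF q that] by (simp add: tendsto_cong)
  qed
  show "\<exists>l. (?r \<longlongrightarrow> l) (at_left t)" if "t > 0"
  proof (cases "t > t0")
    case True
    then show ?thesis using piecewise_cont_at_left[OF q that] by (simp only: tends[OF gt])
  next
    case False
    then have "\<forall>\<^sub>F x in at_left t. ?r x = p x"
      by (auto simp: eventually_at_filter)
    then show ?thesis
      using piecewise_cont_at_left[OF p that] by (simp add: tendsto_cong)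
  qed
qed

text \<open>The one-sided limits bound f on both sides of a point and its value bounds it at the
  point itself; compactness of [0, T] leaves finitely many of these local bounds.\<close>

lemma piecewise_cont_bounded:
  fixes f :: "real \<Rightarrow> real"
  assumes "piecewise_cont f"
  shows "\<exists>B. \<forall>t\<in>{0..T}. \<bar>f t\<bar> \<le> B"
proof -
  have "\<exists>U B. open U \<and> t \<in> U \<and> (\<forall>x\<in>U \<inter> {0..}. \<bar>f x\<bar> \<le> B)" if t: "t \<ge> 0" for t
  proof -
    obtain l where "(f \<longlongrightarrow> l) (at_right t)"
      using piecewise_cont_at_right[OF assms t] by blast
    then have "\<forall>\<^sub>F x in at_right t. \<bar>f x\<bar> < \<bar>l\<bar> + 1"
      by (rule order_tendstoD(2)[OF tendsto_rabs]) auto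
    then have r: "\<forall>\<^sub>F x in nhds t. x > t \<longrightarrow> \<bar>f x\<bar> < \<bar>l\<bar> + 1"
      unfolding eventually_at_filter by (rule eventually_mono) auto
    obtain k where k: "\<forall>\<^sub>F x in nhds t. x < t \<longrightarrow> x \<ge> 0 \<longrightarrow> \<bar>f x\<bar> < \<bar>k\<bar> + 1"
    proof (cases "t = 0")
      case False
      then obtain k where "(f \<longlongrightarrow> k) (at_left t)"
        using piecewise_cont_at_left[OF assms, of t] t by auto
      then have "\<forall>\<^sub>F x in at_left t. \<bar>f x\<bar> < \<bar>k\<bar> + 1"
        by (rule order_tendstoD(2)[OF tendsto_rabs]) auto
      then have "\<forall>\<^sub>F x in nhds t. x < t \<longrightarrow> x \<ge> 0 \<longrightarrow> \<bar>f x\<bar> < \<bar>k\<bar> + 1"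
        unfolding eventually_at_filter by (rule eventually_mono) auto
      then show ?thesis by (rule that)
    qed (auto intro!: that[of 0])
    have "\<forall>\<^sub>F x in nhds t. x \<ge> 0 \<longrightarrow> \<bar>f x\<bar> \<le> \<bar>l\<bar> + \<bar>k\<bar> + \<bar>f t\<bar> + 1"
      using r k by eventually_elim (smt (verit))
    then obtain U where "open U" "t \<in> U" "\<forall>x\<in>U. x \<ge> 0 \<longrightarrow> \<bar>f x\<bar> \<le> \<bar>l\<bar> + \<bar>k\<bar> + \<bar>f t\<bar> + 1"
      by (auto simp: eventually_nhds)
    then show ?thesis by auto
  qed
  then obtain U B where UB: "\<And>t. t \<ge> 0 \<Longrightarrow> open (U t)" "\<And>t. t \<ge> 0 \<Longrightarrow> t \<in> U t"
    "\<And>t x. t \<ge> 0 \<Longrightarrow> x \<in> U t \<Longrightarrow> x \<ge> 0 \<Longrightarrow> \<bar>f x\<bar> \<le> B t"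
    by (metis IntI atLeast_iff)
  have "compact {0..T}" by simp
  then obtain C where C: "C \<subseteq> {0..T}" "finite C" "{0..T} \<subseteq> (\<Union>c\<in>C. U c)"
    by (rule compactE_image[of _ "{0..T}" U]) (use UB in auto)
  have "\<bar>f x\<bar> \<le> (\<Sum>c\<in>C. \<bar>B c\<bar>)" if x: "x \<in> {0..T}" for x
  proof -
    obtain c where c: "c \<in> C" "x \<in> U c" using C x by blast
    then have "\<bar>f x\<bar> \<le> \<bar>B c\<bar>"
      using UB(3)[of c x] C x by fastforce
    also have "\<dots> \<le> (\<Sum>c\<in>C. \<bar>B c\<bar>)"
      by (rule member_le_sum) (use C c in auto)
    finally show ?thesis .
  qed
  then show ?thesis by blast
qed

text \<open>Extended by 0 to negative times, f is continuous off a countable set, hence Borel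
  measurable. The point 0 joins the exceptions because the extension may jump there.\<close>

lemma piecewise_cont_measurable:
  fixes f :: "real \<Rightarrow> real"
  assumes "piecewise_cont f"
  shows "f \<in> borel_measurable (lebesgue_on {0..})"
proof -
  define D where "D = {t. t \<ge> 0 \<and> \<not> continuous (at t within {0..}) f}"
  have "D = (\<Union>n::nat. {t \<in> {0..real n}. \<not> continuous (at t within {0..}) f})"
    by (auto simp: D_def intro: real_arch_simple)
  then have D: "countable D"
    using piecewise_cont_finite[OF assms] by (auto intro: countable_finite)
  define g where "g = (\<lambda>t. if t < 0 then 0 else f t)"
  have "continuous_on (- (insert 0 D)) g"
    unfolding continuous_on_eq_continuous_within
  proof
    fix t assume t: "t \<in> - insert 0 D"
    have "isCont g t"
    proof (cases "t < 0")
      case True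
      then have "\<forall>\<^sub>F x in nhds t. g x = 0"
        by (intro eventually_mono[OF eventually_nhds_in_open[of "{..<0}" t]]) (auto simp: g_def)
      then have "isCont g t = isCont (\<lambda>_. 0::real) t" by (rule isCont_cong)
      then show ?thesis by simp
    next
      case False
      then have "t > 0" using t by auto
      then have "\<forall>\<^sub>F x in nhds t. g x = f x"
        by (intro eventually_mono[OF eventually_nhds_in_open[of "{0<..}" t]]) (auto simp: g_def)
      then have "isCont g t = isCont f t" by (rule isCont_cong)
      moreover have "continuous (at t within {0..}) f"
        using t \<open>t > 0\<close> by (auto simp: D_def)
      moreover have "at t within {0..} = at t"
        by (rule at_within_interior) (use \<open>t > 0\<close> in auto)
      ultimately show ?thesis by simp
    qed
    then show "continuous (at t within - insert 0 D) g"
      by (rule continuous_at_imp_continuous_at_within)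
  qed
  then have "g \<in> borel_measurable borel"
    using D by (intro borel_measurable_continuous_countable_exceptions[of "insert 0 D"]) auto
  then have "g \<in> borel_measurable lebesgue"
    by (simp add: measurable_completion)
  then have "g \<in> borel_measurable (lebesgue_on {0..})"
    by (rule measurable_restrict_space1)
  then show ?thesis
    by (rule measurable_cong[THEN iffD1, rotated]) (auto simp: g_def)
qed

text \<open>Such a product is bounded and measurable on a compact interval. The integrands below are
  built from this shape: components of p and u form the rough factor, iterated integrals or series
  the continuous one.\<close>

lemma piecewise_cont_times_continuous_integrable:
  fixes v \<phi> :: "real \<Rightarrow> real"
  assumes "piecewise_cont v" "0 \<le> a" "continuous_on {a..b} \<phi>"
  shows "(\<lambda>x. v x * \<phi> x) integrable_on {a..b}"
proof -
  obtain V where V: "\<forall>t\<in>{0..b}. \<bar>v t\<bar> \<le> V"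
    using piecewise_cont_bounded[OF assms(1)] by blast
  obtain B where B: "\<forall>x\<in>{a..b}. \<bar>\<phi> x\<bar> \<le> B"
    using compact_imp_bounded[OF compact_continuous_image[OF assms(3)]]
    by (auto simp: bounded_iff)
  have "v \<in> borel_measurable (lebesgue_on {a..b})"
    by (rule measurable_restrict_mono[OF piecewise_cont_measurable[OF assms(1)]])
       (use assms in auto)
  moreover have "\<phi> \<in> borel_measurable (lebesgue_on {a..b})"
    by (rule continuous_imp_measurable_on_sets_lebesgue[OF assms(3)]) auto
  ultimately have "(\<lambda>x. v x * \<phi> x) \<in> borel_measurable (lebesgue_on {a..b})"
    by (rule borel_measurable_times)
  then show ?thesis
  proof (rule measurable_bounded_by_integrable_imp_integrable)
    show "(\<lambda>_. V * B) integrable_on {a..b}" by (rule integrable_const_ivl)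
    show "norm (v x * \<phi> x) \<le> V * B" if "x \<in> {a..b}" for x
      using V B that assms(2) order_trans[OF abs_ge_zero V[rule_format, of x]]
      by (auto simp: abs_mult intro!: mult_mono)
  qed auto
qed

section \<open>Iterated integrals and their generating series\<close>

text \<open>With \<Phi>(b, y) for the integral, the increment from (b0, y0) splits into \<Phi>(b, y)
  - \<Phi>(b, y0), small because \<open>K y\<close> is uniformly close to \<open>K y0\<close> on a
  compact interval, and \<Phi>(b, y0) - \<Phi>(b0, y0), small because an indefinite integral is
  continuous.\<close>

lemma continuous_parametric_integral:
  fixes v :: "real \<Rightarrow> real" and K :: "real \<Rightarrow> real \<Rightarrow> real"
  assumes v: "piecewise_cont v"
    and K: "continuous_on ({0..} \<times> {0..}) (\<lambda>(y, \<sigma>). K y \<sigma>)"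
  shows "continuous_on ({0..} \<times> {0..}) (\<lambda>(b, y). integral {0..b} (\<lambda>\<sigma>. v \<sigma> * K y \<sigma>))"
    (is "continuous_on _ (\<lambda>(b, y). ?\<Phi> b y)")
  unfolding continuous_on_def
proof
  fix z :: "real \<times> real" assume "z \<in> {0..} \<times> {0..}"
  then obtain b0 y0 where z: "z = (b0, y0)" and b0: "b0 \<ge> 0" and y0: "y0 \<ge> 0" by auto
  let ?F = "at (b0, y0) within {0..} \<times> {0..}"
  have K': "continuous_on {0..b} (K y)" if "y \<ge> 0" for y b
  proof -
    have "continuous_on {0..b} (\<lambda>\<sigma>. case (y, \<sigma>) of (y, \<sigma>) \<Rightarrow> K y \<sigma>)"
      by (rule continuous_on_compose2[OF K]) (use that in \<open>auto intro!: continuous_intros\<close>)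
    then show ?thesis by simp
  qed
  have int: "(\<lambda>\<sigma>. v \<sigma> * K y \<sigma>) integrable_on {0..b}" if "y \<ge> 0" for y b
    by (rule piecewise_cont_times_continuous_integrable[OF v _ K'[OF that]]) simp
  \<comment> \<open>The margin 1 keeps all upper limits near b0 inside [0, T], so that one bound on
    \<open>v\<close> and one uniform estimate on \<open>K\<close> serve them all.\<close>
  define T where "T = b0 + 1"
  have T: "T > 0" using b0 by (simp add: T_def)
  have near: "\<forall>\<^sub>F x in ?F. fst x < T \<and> fst x \<ge> 0 \<and> snd x \<ge> 0"
  proof -
    have op: "open ({..<T} \<times> (UNIV :: real set))" by (intro open_Times) auto
    have "\<forall>\<^sub>F x in ?F. x \<in> {..<T} \<times> (UNIV :: real set)"
      unfolding eventually_at_topological by (rule exI[of _ "{..<T} \<times> UNIV"]) (use op in \<open>auto simp: T_def\<close>)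
    moreover have "\<forall>\<^sub>F x in ?F. x \<in> {0..} \<times> {0..}"
      by (auto simp: eventually_at_filter)
    ultimately show ?thesis by eventually_elim auto
  qed
  obtain V0 where V0: "\<forall>t\<in>{0..T}. \<bar>v t\<bar> \<le> V0"
    using piecewise_cont_bounded[OF v] by blast
  define V where "V = \<bar>V0\<bar> + 1"
  have V: "\<bar>v t\<bar> \<le> V" if "t \<in> {0..T}" for t
    using V0 that by (fastforce simp: V_def)
  have V_pos: "V > 0" by (simp add: V_def)
  have "((\<lambda>x. ?\<Phi> (fst x) (snd x) - ?\<Phi> (fst x) y0) \<longlongrightarrow> 0) ?F"
  proof (rule tendstoI)
    fix e :: real assume e: "e > 0"
    define e' where "e' = e / (2 * V * T)"
    have e': "e' > 0" using e V_pos T by (simp add: e'_def)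
    have "continuous_on ({0..} \<times> {0..T}) (\<lambda>(y, \<sigma>). K y \<sigma>)"
      by (rule continuous_on_subset[OF K]) auto
    then obtain X where X: "y0 \<in> X" "open X"
      "\<forall>y\<in>X \<inter> {0..}. \<forall>\<sigma>\<in>{0..T}. dist (K y \<sigma>) (K y0 \<sigma>) \<le> e'"
      using continuous_on_prod_compactE[of "{0..}" "{0..T}" "\<lambda>(y, \<sigma>). K y \<sigma>" y0 e'] y0 e'
      by auto
    have op: "open ((UNIV :: real set) \<times> X)" using X by (simp add: open_Times)
    have "\<forall>\<^sub>F x in ?F. x \<in> (UNIV :: real set) \<times> X"
      unfolding eventually_at_topological by (rule exI[of _ "UNIV \<times> X"]) (use op X in auto)
    with near show "\<forall>\<^sub>F x in ?F. dist (?\<Phi> (fst x) (snd x) - ?\<Phi> (fst x) y0) 0 < e"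
    proof eventually_elim
      case (elim x)
      let ?b = "fst x" and ?y = "snd x"
      have "?\<Phi> ?b ?y - ?\<Phi> ?b y0 = integral {0..?b} (\<lambda>\<sigma>. v \<sigma> * K ?y \<sigma> - v \<sigma> * K y0 \<sigma>)"
        using elim y0 by (intro Henstock_Kurzweil_Integration.integral_diff[symmetric] int) auto
      also have "norm \<dots> \<le> integral {0..?b} (\<lambda>_. V * e')"
      proof (rule integral_norm_bound_integral)
        show "(\<lambda>\<sigma>. v \<sigma> * K ?y \<sigma> - v \<sigma> * K y0 \<sigma>) integrable_on {0..?b}"
          using elim y0 by (intro Henstock_Kurzweil_Integration.integrable_diff int) auto
        fix \<sigma> assume "\<sigma> \<in> {0..?b}"
        then have \<sigma>: "\<sigma> \<in> {0..T}" using elim by auto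
        have "\<bar>v \<sigma>\<bar> * \<bar>K ?y \<sigma> - K y0 \<sigma>\<bar> \<le> V * e'"
          using V[OF \<sigma>] X(3) \<sigma> elim V_pos
          by (intro mult_mono) (auto simp: dist_real_def mem_Times_iff)
        then show "norm (v \<sigma> * K ?y \<sigma> - v \<sigma> * K y0 \<sigma>) \<le> V * e'"
          by (simp add: abs_mult flip: right_diff_distrib)
      qed (rule integrable_const_ivl)
      also have "\<dots> = ?b * (V * e')" using elim by simp
      also have "\<dots> \<le> T * (V * e')"
        using elim V_pos e' by (intro mult_right_mono) auto
      also have "\<dots> = e / 2" using T V_pos by (simp add: e'_def)
      also have "\<dots> < e" using e by simp
      finally show ?case by simp
    qed
  qed
  moreover have "((\<lambda>x. ?\<Phi> (fst x) y0) \<longlongrightarrow> ?\<Phi> b0 y0) ?F"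
  proof -
    have "continuous_on {0..T} (\<lambda>b. ?\<Phi> b y0)"
      by (rule indefinite_integral_continuous_1[OF int[OF y0]])
    then have "continuous_on ({0..T} \<times> {0..}) (\<lambda>x. ?\<Phi> (fst x) y0)"
      by (rule continuous_on_compose2) (auto intro!: continuous_intros)
    then have "((\<lambda>x. ?\<Phi> (fst x) y0) \<longlongrightarrow> ?\<Phi> b0 y0) (at (b0, y0) within {0..T} \<times> {0..})"
      using b0 y0 unfolding continuous_on_def T_def by force
    moreover have "at (b0, y0) within {0..T} \<times> {0..} = ?F"
      by (rule at_within_nhd[where S="{..<T} \<times> UNIV"]) (auto simp: T_def intro!: open_Times)
    ultimately show ?thesis by simp
  qed
  ultimately have "((\<lambda>x. (?\<Phi> (fst x) (snd x) - ?\<Phi> (fst x) y0) + ?\<Phi> (fst x) y0) \<longlongrightarrow> 0 + ?\<Phi> b0 y0) ?F"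
    by (rule tendsto_add)
  then show "((\<lambda>(b, y). ?\<Phi> b y) \<longlongrightarrow> (case z of (b, y) \<Rightarrow> ?\<Phi> b y)) (at z within {0..} \<times> {0..})"
    by (simp add: z case_prod_beta')
qed

section \<open>Continuity and growth of iterated integrals on ordered pairs of times\<close>

definition time_triangle :: "(real \<times> real) set" where
  "time_triangle = {(t, \<tau>). 0 \<le> \<tau> \<and> \<tau> \<le> t}"

lemma continuous_on_time_triangle_slice:
  assumes "continuous_on time_triangle (\<lambda>(t, \<tau>). H t \<tau>)"
  shows "0 \<le> \<tau> \<Longrightarrow> continuous_on {\<tau>..} (\<lambda>t. H t \<tau>)"
    and "continuous_on {0..t} (H t)"
proof -
  assume "0 \<le> \<tau>"
  then have "continuous_on {\<tau>..} (\<lambda>t. case (t, \<tau>) of (t, \<tau>) \<Rightarrow> H t \<tau>)"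
    by (intro continuous_on_compose2[OF assms] continuous_intros) (auto simp: time_triangle_def)
  then show "continuous_on {\<tau>..} (\<lambda>t. H t \<tau>)" by simp
next
  have "continuous_on {0..t} (\<lambda>\<tau>. case (t, \<tau>) of (t, \<tau>) \<Rightarrow> H t \<tau>)"
    by (intro continuous_on_compose2[OF assms] continuous_intros) (auto simp: time_triangle_def)
  then show "continuous_on {0..t} (H t)" by simp
qed

text \<open>The time t is both the upper limit and a parameter of the integrand. The two roles are
  separated into b and y and then rejoined on the diagonal b = y = t. Clamping the first argument of
  \<open>H\<close> to \<open>max y \<sigma>\<close> extends it from the triangle to the quadrant and
  changes nothing where \<sigma> \<le> t.\<close>

lemma continuous_integral_time_triangle:
  fixes v :: "real \<Rightarrow> real" and H :: "real \<Rightarrow> real \<Rightarrow> real"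
  assumes v: "piecewise_cont v"
    and H: "continuous_on time_triangle (\<lambda>(t, \<tau>). H t \<tau>)"
  shows "continuous_on {0..} (\<lambda>t. integral {0..t} (\<lambda>\<sigma>. v \<sigma> * H t \<sigma>))"
proof -
  have "continuous_on ({0..} \<times> {0..}) (\<lambda>x. case (max (fst x) (snd x), snd x) of (t, \<tau>) \<Rightarrow> H t \<tau>)"
    by (intro continuous_on_compose2[OF H] continuous_intros) (auto simp: time_triangle_def)
  then have "continuous_on ({0..} \<times> {0..}) (\<lambda>(y, \<sigma>). H (max y \<sigma>) \<sigma>)"
    by (simp add: case_prod_beta')
  note \<Phi> = continuous_parametric_integral[OF v this]
  have "continuous_on {0..} (\<lambda>t. case (t, t) of (b, y) \<Rightarrow> integral {0..b} (\<lambda>\<sigma>. v \<sigma> * H (max y \<sigma>) \<sigma>))"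
    by (intro continuous_on_compose2[OF \<Phi>] continuous_intros) auto
  then show ?thesis
    by (rule continuous_on_eq) (auto intro!: integral_cong simp: max_def)
qed

text \<open>The lower limit varies too, so the integral over [\<tau>, t] is written as a difference
  of integrals over [0, t] and [0, \<tau>]. This calls for an integrand at times before \<tau>;
  \<open>K\<close> provides one by freezing the inner iterated integral at its value on the
  diagonal.\<close>

lemma ct_w_continuous:
  assumes p: "piecewise_cont p"
  shows "continuous_on time_triangle (\<lambda>(t, \<tau>). ct_w p s t \<tau>)"
proof (induction s rule: rev_induct)
  case Nil
  then show ?case by (simp add: ct_w_Nil)
next
  case (snoc i s)
  let ?v = "\<lambda>\<sigma>. aug p \<sigma> i"
  define K where "K y \<sigma> = ct_w p s (max \<sigma> y) y" for y \<sigma>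
  have "continuous_on ({0..} \<times> {0..}) (\<lambda>x. case (max (snd x) (fst x), fst x) of (t, \<tau>) \<Rightarrow> ct_w p s t \<tau>)"
    by (intro continuous_on_compose2[OF snoc] continuous_intros) (auto simp: time_triangle_def)
  then have K: "continuous_on ({0..} \<times> {0..}) (\<lambda>(y, \<sigma>). K y \<sigma>)"
    by (simp add: case_prod_beta' K_def)
  note \<Phi> = continuous_parametric_integral[OF piecewise_cont_aug[OF p, of i] K]
  let ?\<Phi> = "\<lambda>b y. integral {0..b} (\<lambda>\<sigma>. ?v \<sigma> * K y \<sigma>)"
  have "continuous_on time_triangle (\<lambda>x. (case (fst x, snd x) of (b, y) \<Rightarrow> ?\<Phi> b y) - (case (snd x, snd x) of (b, y) \<Rightarrow> ?\<Phi> b y))"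
    by (intro continuous_on_diff continuous_on_compose2[OF \<Phi>] continuous_intros)
       (auto simp: time_triangle_def)
  then show ?case
  proof (rule continuous_on_eq)
    fix x assume "x \<in> time_triangle"
    then obtain t \<tau> where x: "x = (t, \<tau>)" and t: "0 \<le> \<tau>" "\<tau> \<le> t"
      by (auto simp: time_triangle_def)
    have "continuous_on {0..t} (\<lambda>\<sigma>. case (\<tau>, \<sigma>) of (y, \<sigma>) \<Rightarrow> K y \<sigma>)"
      by (rule continuous_on_compose2[OF K]) (use t in \<open>auto intro!: continuous_intros\<close>)
    then have "(\<lambda>\<sigma>. ?v \<sigma> * K \<tau> \<sigma>) integrable_on {0..t}"
      by (intro piecewise_cont_times_continuous_integrable piecewise_cont_aug p) auto
    then have "?\<Phi> \<tau> \<tau> + integral {\<tau>..t} (\<lambda>\<sigma>. ?v \<sigma> * K \<tau> \<sigma>) = ?\<Phi> t \<tau>"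
      using t by (intro Henstock_Kurzweil_Integration.integral_combine) auto
    moreover have "integral {\<tau>..t} (\<lambda>\<sigma>. ?v \<sigma> * K \<tau> \<sigma>) = ct_w p (s @ [i]) t \<tau>"
      unfolding ct_w_snoc by (intro integral_cong) (auto simp: K_def)
    ultimately show "(case (fst x, snd x) of (b, y) \<Rightarrow> ?\<Phi> b y) - (case (snd x, snd x) of (b, y) \<Rightarrow> ?\<Phi> b y)
        = (case x of (t, \<tau>) \<Rightarrow> ct_w p (s @ [i]) t \<tau>)"
      by (simp add: x)
  qed
qed

text \<open>Up to the factor M ^ n this is the volume of the simplex of n ordered times in
  [\<tau>, t], with n the length of s. The factorial is what makes the series converge for any
  geometric growth of the coefficients and any piecewise continuous p.\<close>

lemma ct_w_bound:
  assumes p: "piecewise_cont p" and M: "\<And>i \<sigma>. \<sigma> \<in> {0..T} \<Longrightarrow> \<bar>aug p \<sigma> i\<bar> \<le> M"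
    and t: "0 \<le> \<tau>" "\<tau> \<le> t" "t \<le> T"
  shows "\<bar>ct_w p s t \<tau>\<bar> \<le> (M * (t - \<tau>)) ^ length s / fact (length s)"
  using t
proof (induction s arbitrary: t rule: rev_induct)
  case Nil
  then show ?case by (simp add: ct_w_Nil)
next
  case (snoc i s)
  let ?n = "length s"
  let ?b = "\<lambda>\<sigma>. M * ((M * (\<sigma> - \<tau>)) ^ ?n / fact ?n)"
  have M0: "M \<ge> 0" using M[of \<tau> None] snoc by auto
  have "((\<lambda>\<sigma>. (M * (\<sigma> - \<tau>)) ^ Suc ?n / fact (Suc ?n)) has_vector_derivative ?b \<sigma>) (at \<sigma> within {\<tau>..t})" for \<sigma>
  proof -
    have "((\<lambda>\<sigma>. (M * (\<sigma> - \<tau>)) ^ Suc ?n / fact (Suc ?n)) has_real_derivative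
        (real (Suc ?n) * (M * (\<sigma> - \<tau>)) ^ ?n * M) / fact (Suc ?n)) (at \<sigma> within {\<tau>..t})"
      by (rule DERIV_cdivide[OF DERIV_cong[OF DERIV_power_Suc[where D=M]]])
         (auto intro!: derivative_eq_intros simp del: power_Suc simp: mult_ac)
    moreover have "(real (Suc ?n) * (M * (\<sigma> - \<tau>)) ^ ?n * M) / fact (Suc ?n) = ?b \<sigma>"
      by (simp add: fact_Suc del: of_nat_Suc)
    ultimately show ?thesis
      by (simp only: has_real_derivative_iff_has_vector_derivative)
  qed
  then have int: "(?b has_integral ((M * (t - \<tau>)) ^ Suc ?n / fact (Suc ?n))) {\<tau>..t}"
    using fundamental_theorem_of_calculus[of \<tau> t "\<lambda>\<sigma>. (M * (\<sigma> - \<tau>)) ^ Suc ?n / fact (Suc ?n)" ?b] snoc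
    by simp
  have "norm (integral {\<tau>..t} (\<lambda>\<sigma>. aug p \<sigma> i * ct_w p s \<sigma> \<tau>)) \<le> integral {\<tau>..t} ?b"
  proof (rule integral_norm_bound_integral)
    have "continuous_on {\<tau>..t} (\<lambda>\<sigma>. ct_w p s \<sigma> \<tau>)"
      by (rule continuous_on_subset[OF continuous_on_time_triangle_slice(1)[OF ct_w_continuous[OF p]]])
         (use snoc in auto)
    then show "(\<lambda>\<sigma>. aug p \<sigma> i * ct_w p s \<sigma> \<tau>) integrable_on {\<tau>..t}"
      using snoc by (intro piecewise_cont_times_continuous_integrable piecewise_cont_aug p) auto
    show "?b integrable_on {\<tau>..t}" using int by blast
    fix \<sigma> assume "\<sigma> \<in> {\<tau>..t}"
    then show "norm (aug p \<sigma> i * ct_w p s \<sigma> \<tau>) \<le> ?b \<sigma>"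
      using snoc M M0 unfolding real_norm_def abs_mult by (intro mult_mono) auto
  qed
  then show ?case
    by (simp only: integral_unique[OF int] ct_w_snoc length_append_singleton real_norm_def)
qed

text \<open>There are \<open>CARD('a) ^ n\<close> words of length n, so summation by length yields K
  times the exponential series at \<open>CARD('a) * L\<close>, a bound for all finite partial
  sums.\<close>

lemma summable_on_lists_exp:
  fixes K L :: real
  assumes "K \<ge> 0" "L \<ge> 0"
  shows "(\<lambda>s :: 'a::finite list. K * L ^ length s / fact (length s)) summable_on UNIV"
proof (rule nonneg_bdd_above_summable_on)
  let ?N = "real (CARD('a))"
  show "bdd_above (sum (\<lambda>s :: 'a list. K * L ^ length s / fact (length s)) ` {F. F \<subseteq> UNIV \<and> finite F})"
  proof (rule bdd_aboveI2)
    fix F :: "'a list set" assume "F \<in> {F. F \<subseteq> UNIV \<and> finite F}"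
    then have F: "finite F" by simp
    define m where "m = Max (insert 0 (length ` F))"
    have fin: "finite {s :: 'a list. length s = n}" for n
      using finite_lists_length_eq[of "UNIV :: 'a set" n] by simp
    have crd: "card {s :: 'a list. length s = n} = CARD('a) ^ n" for n
      using card_lists_length_eq[of "UNIV :: 'a set" n] by simp
    have sub: "F \<subseteq> (\<Union>n\<in>{..m}. {s. length s = n})"
      using F by (auto simp: m_def)
    have "(\<Sum>s\<in>F. K * L ^ length s / fact (length s))
        \<le> (\<Sum>s\<in>(\<Union>n\<in>{..m}. {s :: 'a list. length s = n}). K * L ^ length s / fact (length s))"
      by (rule sum_mono2[OF _ sub]) (use fin assms in auto)
    also have "\<dots> = (\<Sum>n\<le>m. \<Sum>s\<in>{s :: 'a list. length s = n}. K * L ^ length s / fact (length s))"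
      by (rule sum.UNION_disjoint) (use fin in auto)
    also have "\<dots> = (\<Sum>n\<le>m. K * (inverse (fact n) *\<^sub>R (?N * L) ^ n))"
      by (intro sum.cong) (simp_all add: crd power_mult_distrib field_simps)
    also have "\<dots> = K * (\<Sum>n\<le>m. inverse (fact n) *\<^sub>R (?N * L) ^ n)"
      by (simp add: sum_distrib_left)
    also have "\<dots> \<le> K * (\<Sum>n. inverse (fact n) *\<^sub>R (?N * L) ^ n)"
      using assms summable_exp_generic[of "?N * L"]
      by (intro mult_left_mono sum_le_suminf) auto
    finally show "(\<Sum>s\<in>F. K * L ^ length s / fact (length s)) \<le> K * (\<Sum>n. inverse (fact n) *\<^sub>R (?N * L) ^ n)" .
  qed
qed (use assms in auto)

section \<open>Series over all words with geometrically bounded coefficients\<close>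

definition geometric_growth :: "('a list \<Rightarrow> real) \<Rightarrow> bool" where
  "geometric_growth c \<longleftrightarrow> (\<exists>K R. K \<ge> 0 \<and> R \<ge> 0 \<and> (\<forall>s. \<bar>c s\<bar> \<le> K * R ^ length s))"

lemma geometric_growth_snoc:
  assumes "geometric_growth c"
  shows "geometric_growth (\<lambda>s. c (s @ [i]))"
proof -
  obtain K R where "K \<ge> 0" "R \<ge> 0" "\<forall>s. \<bar>c s\<bar> \<le> K * R ^ length s"
    using assms by (auto simp: geometric_growth_def)
  then have "\<bar>c (s @ [i])\<bar> \<le> (K * R) * R ^ length s" for s
    by (metis length_append_singleton mult.assoc power_Suc)
  then show ?thesis
    using \<open>K \<ge> 0\<close> \<open>R \<ge> 0\<close> unfolding geometric_growth_def by (metis mult_nonneg_nonneg)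
qed

lemma geometric_growth_diff:
  assumes "geometric_growth c" "geometric_growth d"
  shows "geometric_growth (\<lambda>s. c s - d s)"
proof -
  obtain K R where c: "K \<ge> 0" "R \<ge> 0" "\<And>s. \<bar>c s\<bar> \<le> K * R ^ length s"
    using assms(1) by (auto simp: geometric_growth_def)
  obtain K' R' where d: "K' \<ge> 0" "R' \<ge> 0" "\<And>s. \<bar>d s\<bar> \<le> K' * R' ^ length s"
    using assms(2) by (auto simp: geometric_growth_def)
  have "\<bar>c s - d s\<bar> \<le> (K + K') * (max R R') ^ length s" for s
  proof -
    have "\<bar>c s - d s\<bar> \<le> K * R ^ length s + K' * R' ^ length s"
      using c(3)[of s] d(3)[of s] by linarith
    also have "\<dots> \<le> K * (max R R') ^ length s + K' * (max R R') ^ length s"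
      using c d by (intro add_mono mult_left_mono power_mono) auto
    finally show ?thesis by (simp add: distrib_right)
  qed
  then show ?thesis
    using c d unfolding geometric_growth_def
    by (intro exI[of _ "K + K'"] exI[of _ "max R R'"]) auto
qed

text \<open>A Chen-Fliess series in the channels 1, p_1, p_2, ..., started at \<tau>. The entries of
  g and h are combinations of such series with factors p_i(t) and p_j(\<delta>).\<close>

definition ct_series :: "('p::finite option list \<Rightarrow> real) \<Rightarrow> (real \<Rightarrow> real ^ 'p) \<Rightarrow> real \<Rightarrow> real \<Rightarrow> real" where
  "ct_series c p t \<tau> = (\<Sum>\<^sub>\<infinity>s. c s * ct_w p s t \<tau>)"

lemma aug_bounded:
  fixes p :: "real \<Rightarrow> real ^ 'p::finite"
  assumes "piecewise_cont p"
  obtains M where "M \<ge> 0" "\<And>i \<sigma>. \<sigma> \<in> {0..T} \<Longrightarrow> \<bar>aug p \<sigma> i\<bar> \<le> M"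
proof -
  obtain B where B: "\<And>i \<sigma>. \<sigma> \<in> {0..T} \<Longrightarrow> \<bar>aug p \<sigma> i\<bar> \<le> B i"
    using piecewise_cont_bounded[OF piecewise_cont_aug[OF assms], of T] by metis
  show ?thesis
  proof (rule that)
    show "0 \<le> (\<Sum>i\<in>UNIV. \<bar>B i\<bar>)" by (simp add: sum_nonneg)
    fix i \<sigma> assume "\<sigma> \<in> {0..T}"
    then have "\<bar>aug p \<sigma> i\<bar> \<le> \<bar>B i\<bar>" using B[of \<sigma> i] by linarith
    also have "\<dots> \<le> (\<Sum>i\<in>UNIV. \<bar>B i\<bar>)" by (rule member_le_sum) auto
    finally show "\<bar>aug p \<sigma> i\<bar> \<le> (\<Sum>i\<in>UNIV. \<bar>B i\<bar>)" .
  qed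
qed

text \<open>The majorant depends on T but not on the two times, as the Weierstrass test requires.
  The absolute value of T keeps it nonnegative for negative T, where no admissible times
  exist.\<close>

lemma ct_series_majorant:
  fixes p :: "real \<Rightarrow> real ^ 'p::finite"
  assumes p: "piecewise_cont p" and c: "geometric_growth c"
  obtains m :: "'p option list \<Rightarrow> real" where "m summable_on UNIV"
    "\<And>s t \<tau>. 0 \<le> \<tau> \<Longrightarrow> \<tau> \<le> t \<Longrightarrow> t \<le> T \<Longrightarrow> \<bar>c s * ct_w p s t \<tau>\<bar> \<le> m s"
proof -
  obtain K R where c: "K \<ge> 0" "R \<ge> 0" "\<And>s. \<bar>c s\<bar> \<le> K * R ^ length s"
    using c by (auto simp: geometric_growth_def)
  obtain M where M: "M \<ge> 0" "\<And>i \<sigma>. \<sigma> \<in> {0..T} \<Longrightarrow> \<bar>aug p \<sigma> i\<bar> \<le> M"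
    using aug_bounded[OF p] by blast
  let ?L = "R * (M * \<bar>T\<bar>)"
  show ?thesis
  proof (rule that)
    show "(\<lambda>s :: 'p option list. K * ?L ^ length s / fact (length s)) summable_on UNIV"
      using c M by (intro summable_on_lists_exp) auto
    fix s t \<tau> assume t: "0 \<le> \<tau>" "\<tau> \<le> t" "t \<le> T"
    have "\<bar>ct_w p s t \<tau>\<bar> \<le> (M * (t - \<tau>)) ^ length s / fact (length s)"
      by (rule ct_w_bound[OF p M(2) t])
    also have "\<dots> \<le> (M * \<bar>T\<bar>) ^ length s / fact (length s)"
      using M t by (intro divide_right_mono power_mono mult_left_mono mult_nonneg_nonneg) auto
    finally have "\<bar>c s * ct_w p s t \<tau>\<bar> \<le> (K * R ^ length s) * ((M * \<bar>T\<bar>) ^ length s / fact (length s))"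
      unfolding abs_mult using c by (intro mult_mono) auto
    then show "\<bar>c s * ct_w p s t \<tau>\<bar> \<le> K * ?L ^ length s / fact (length s)"
      by (simp add: power_mult_distrib mult_ac)
  qed
qed

lemma ct_series_summable:
  fixes p :: "real \<Rightarrow> real ^ 'p::finite"
  assumes "piecewise_cont p" "geometric_growth c" "0 \<le> \<tau>" "\<tau> \<le> t"
  shows "(\<lambda>s. c s * ct_w p s t \<tau>) summable_on UNIV"
proof -
  obtain m where m: "m summable_on UNIV" "\<And>s t' \<tau>. 0 \<le> \<tau> \<Longrightarrow> \<tau> \<le> t' \<Longrightarrow> t' \<le> t \<Longrightarrow> \<bar>c s * ct_w p s t' \<tau>\<bar> \<le> m s"
    using ct_series_majorant[OF assms(1,2)] by metis
  show ?thesis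
    by (rule abs_summable_summable[OF Infinite_Sum.abs_summable_on_comparison_test'[OF m(1)]])
       (simp add: m(2) assms)
qed

lemma ct_series_uniform_limit:
  fixes p :: "real \<Rightarrow> real ^ 'p::finite"
  assumes "piecewise_cont p" "geometric_growth c"
  shows "uniform_limit (time_triangle \<inter> {..T} \<times> UNIV) (\<lambda>X (t, \<tau>). \<Sum>s\<in>X. c s * ct_w p s t \<tau>)
    (\<lambda>(t, \<tau>). ct_series c p t \<tau>) (finite_subsets_at_top UNIV)"
proof -
  obtain m where m: "m summable_on UNIV"
    "\<And>s t \<tau>. 0 \<le> \<tau> \<Longrightarrow> \<tau> \<le> t \<Longrightarrow> t \<le> T \<Longrightarrow> \<bar>c s * ct_w p s t \<tau>\<bar> \<le> m s"
    using ct_series_majorant[OF assms] by metis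
  have "uniform_limit (time_triangle \<inter> {..T} \<times> UNIV)
     (\<lambda>X x. \<Sum>s\<in>X. c s * ct_w p s (fst x) (snd x))
     (\<lambda>x. \<Sum>\<^sub>\<infinity>s. c s * ct_w p s (fst x) (snd x)) (finite_subsets_at_top UNIV)"
    by (rule Weierstrass_m_test_general[of UNIV _ _ m]) (use m in \<open>auto simp: time_triangle_def\<close>)
  then show ?thesis by (simp add: ct_series_def case_prod_beta')
qed

lemma ct_series_continuous:
  fixes p :: "real \<Rightarrow> real ^ 'p::finite"
  assumes "piecewise_cont p" "geometric_growth c"
  shows "continuous_on time_triangle (\<lambda>(t, \<tau>). ct_series c p t \<tau>)"
  unfolding continuous_on_eq_continuous_within
proof
  fix x assume x: "x \<in> time_triangle"
  \<comment> \<open>Convergence is uniform for bounded t only; continuity being local, a bound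
    beyond the given point suffices.\<close>
  define T where "T = fst x + 1"
  let ?S = "\<lambda>(t, \<tau>). ct_series c p t \<tau>"
  have "continuous_on (time_triangle \<inter> {..T} \<times> UNIV) ?S"
  proof (rule uniform_limit_theorem[OF _ ct_series_uniform_limit[OF assms]])
    show "\<forall>\<^sub>F X in finite_subsets_at_top UNIV. continuous_on (time_triangle \<inter> {..T} \<times> UNIV)
         (\<lambda>(t, \<tau>). \<Sum>s\<in>X. c s * ct_w p s t \<tau>)"
      unfolding case_prod_beta'
      by (intro always_eventually allI continuous_on_sum continuous_on_mult continuous_on_const
          continuous_on_subset[OF ct_w_continuous[OF assms(1), unfolded case_prod_beta']]) auto
  qed simp
  moreover have "x \<in> time_triangle \<inter> {..T} \<times> UNIV"
    using x by (simp add: T_def mem_Times_iff)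
  ultimately have "continuous (at x within time_triangle \<inter> {..T} \<times> UNIV) ?S"
    unfolding continuous_on_eq_continuous_within by blast
  moreover have "at x within time_triangle \<inter> {..T} \<times> UNIV = at x within time_triangle"
    by (rule at_within_nhd[where S="{..<T} \<times> UNIV"]) (auto simp: T_def mem_Times_iff intro!: open_Times)
  ultimately show "continuous (at x within time_triangle) ?S" by simp
qed

lemma ct_series_diff:
  fixes p :: "real \<Rightarrow> real ^ 'p::finite"
  assumes "piecewise_cont p" "geometric_growth c" "geometric_growth d" "0 \<le> \<tau>" "\<tau> \<le> t"
  shows "ct_series (\<lambda>s. c s - d s) p t \<tau> = ct_series c p t \<tau> - ct_series d p t \<tau>"
  unfolding ct_series_def left_diff_distrib
  using has_sum_add[OF has_sum_infsum[OF ct_series_summable[OF assms(1,2,4,5)]]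
      has_sum_uminusI[OF has_sum_infsum[OF ct_series_summable[OF assms(1,3,4,5)]]]]
  by (intro infsumI) simp

text \<open>A bounded weight preserves uniform convergence even when it jumps. The filter is general
  because series over words converge along finite sets of words and not along a sequence.\<close>

lemma integral_uniform_limit_weighted:
  fixes v :: "real \<Rightarrow> real" and f :: "'i \<Rightarrow> real \<Rightarrow> real"
  assumes v: "piecewise_cont v" and a: "0 \<le> a" "a \<le> b"
    and f: "\<And>n. continuous_on {a..b} (f n)" and lim: "uniform_limit {a..b} f g F" and F: "F \<noteq> bot"
  shows "((\<lambda>n. integral {a..b} (\<lambda>x. v x * f n x)) \<longlongrightarrow> integral {a..b} (\<lambda>x. v x * g x)) F"
proof (rule tendstoI)
  fix e :: real assume e: "e > 0"
  have g: "continuous_on {a..b} g"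
    by (rule uniform_limit_theorem[OF _ lim F]) (use f in auto)
  obtain V0 where V0: "\<forall>t\<in>{0..b}. \<bar>v t\<bar> \<le> V0"
    using piecewise_cont_bounded[OF v] by blast
  define V where "V = \<bar>V0\<bar> + 1"
  have V: "\<bar>v t\<bar> \<le> V" if "t \<in> {a..b}" for t
    using V0[rule_format, of t] that a by (auto simp: V_def)
  have V_pos: "V > 0" by (simp add: V_def)
  define L where "L = b - a + 1"
  have L: "L > 0" "b - a \<le> L" using a by (auto simp: L_def)
  define e' where "e' = e / (2 * V * L)"
  have e': "e' > 0" using e V_pos L by (simp add: e'_def)
  have "\<forall>\<^sub>F n in F. \<forall>x\<in>{a..b}. dist (f n x) (g x) < e'"
    using lim e' by (auto simp: uniform_limit_iff)
  then show "\<forall>\<^sub>F n in F. dist (integral {a..b} (\<lambda>x. v x * f n x)) (integral {a..b} (\<lambda>x. v x * g x)) < e"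
  proof eventually_elim
    case (elim n)
    note int = piecewise_cont_times_continuous_integrable[OF v a(1)]
    have "integral {a..b} (\<lambda>x. v x * f n x) - integral {a..b} (\<lambda>x. v x * g x) =
        integral {a..b} (\<lambda>x. v x * f n x - v x * g x)"
      by (intro Henstock_Kurzweil_Integration.integral_diff[symmetric] int f g)
    also have "norm \<dots> \<le> integral {a..b} (\<lambda>_. V * e')"
    proof (rule integral_norm_bound_integral)
      show "(\<lambda>x. v x * f n x - v x * g x) integrable_on {a..b}"
        by (intro Henstock_Kurzweil_Integration.integrable_diff int f g)
      fix x assume x: "x \<in> {a..b}"
      have "\<bar>v x\<bar> * \<bar>f n x - g x\<bar> \<le> V * e'"
        using V[OF x] elim x V_pos by (intro mult_mono) (auto simp: dist_real_def less_imp_le)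
      then show "norm (v x * f n x - v x * g x) \<le> V * e'"
        by (simp add: abs_mult flip: right_diff_distrib)
    qed (rule integrable_const_ivl)
    also have "\<dots> = (b - a) * (V * e')" using a by simp
    also have "\<dots> \<le> L * (V * e')"
      using V_pos e' L by (intro mult_right_mono) auto
    also have "\<dots> = e / 2" using V_pos L by (simp add: e'_def)
    also have "\<dots> < e" using e by simp
    finally show ?case by (simp add: dist_norm)
  qed
qed

text \<open>A nonempty word is uniquely a word followed by a last letter. The last letter is the one
  split off because \<open>ct_w\<close> integrates it outermost.\<close>

lemma infsum_lists_snoc:
  fixes f :: "'a::finite list \<Rightarrow> real"
  assumes f: "f summable_on UNIV"
  shows "(\<Sum>\<^sub>\<infinity>s. f s) = f [] + (\<Sum>i\<in>UNIV. \<Sum>\<^sub>\<infinity>s. f (s @ [i]))"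
proof -
  let ?h = "\<lambda>(i, s :: 'a list). s @ [i]"
  have h: "bij_betw ?h UNIV (UNIV - {[]})"
    by (rule bij_betw_byWitness[where f'="\<lambda>s. (last s, butlast s)"]) auto
  have UNIV: "UNIV = insert [] (UNIV - {[] :: 'a list})" by auto
  have f': "f summable_on (UNIV - {[]})"
    by (rule summable_on_subset_banach[OF f]) auto
  then have "(\<Sum>\<^sub>\<infinity>s. f s) = f [] + infsum f (UNIV - {[]})"
    by (subst UNIV, subst infsum_insert) auto
  also have "infsum f (UNIV - {[]}) = (\<Sum>\<^sub>\<infinity>x. f (?h x))"
    by (rule infsum_reindex_bij_betw[OF h, symmetric])
  also have "\<dots> = (\<Sum>\<^sub>\<infinity>i. \<Sum>\<^sub>\<infinity>s. f (?h (i, s)))"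
  proof -
    have "(\<lambda>x. f (?h x)) summable_on (SIGMA i:UNIV. UNIV)"
      using summable_on_reindex_bij_betw[OF h, of f] f' by simp
    from infsum_Sigma_banach[OF this] show ?thesis by simp
  qed
  finally show ?thesis by simp
qed

text \<open>Integrated form of a differential equation: the t-derivative of the series of c is the
  sum over i of p_i times the series of the shifted coefficients, with initial value
  \<open>c []\<close> at t = \<tau>. The integrated form tolerates jumps of p. Summation and
  integration commute by uniform convergence.\<close>

lemma ct_series_snoc:
  fixes p :: "real \<Rightarrow> real ^ 'p::finite"
  assumes p: "piecewise_cont p" and c: "geometric_growth c" and t: "0 \<le> \<tau>" "\<tau> \<le> t"
  shows "ct_series c p t \<tau> = c [] +
    integral {\<tau>..t} (\<lambda>\<sigma>. \<Sum>i\<in>UNIV. aug p \<sigma> i * ct_series (\<lambda>s. c (s @ [i])) p \<sigma> \<tau>)"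
proof -
  let ?c = "\<lambda>i s. c (s @ [i])"
  have slice: "continuous_on {\<tau>..t} (\<lambda>\<sigma>. H \<sigma> \<tau>)"
    if "continuous_on time_triangle (\<lambda>(t, \<tau>). H t \<tau>)" for H :: "real \<Rightarrow> real \<Rightarrow> real"
    by (rule continuous_on_subset[OF continuous_on_time_triangle_slice(1)[OF that]]) (use t in auto)
  note w_cont = slice[OF ct_w_continuous[OF p]]
    and S_cont = slice[OF ct_series_continuous[OF p geometric_growth_snoc[OF c]]]
  have swap: "(\<Sum>\<^sub>\<infinity>s. ?c i s * ct_w p (s @ [i]) t \<tau>) =
      integral {\<tau>..t} (\<lambda>\<sigma>. aug p \<sigma> i * ct_series (?c i) p \<sigma> \<tau>)" for i
  proof (rule infsumI)
    have "uniform_limit {\<tau>..t} (\<lambda>X \<sigma>. case (\<sigma>, \<tau>) of (t, \<tau>) \<Rightarrow> \<Sum>s\<in>X. ?c i s * ct_w p s t \<tau>)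
        (\<lambda>\<sigma>. case (\<sigma>, \<tau>) of (t, \<tau>) \<Rightarrow> ct_series (?c i) p t \<tau>) (finite_subsets_at_top UNIV)"
      by (rule uniform_limit_compose'[OF ct_series_uniform_limit[OF p geometric_growth_snoc[OF c], where T=t]])
         (use t in \<open>auto simp: time_triangle_def\<close>)
    then have lim: "uniform_limit {\<tau>..t} (\<lambda>X \<sigma>. \<Sum>s\<in>X. ?c i s * ct_w p s \<sigma> \<tau>)
        (\<lambda>\<sigma>. ct_series (?c i) p \<sigma> \<tau>) (finite_subsets_at_top UNIV)" by simp
    have tendsto: "((\<lambda>X. integral {\<tau>..t} (\<lambda>\<sigma>. aug p \<sigma> i * (\<Sum>s\<in>X. ?c i s * ct_w p s \<sigma> \<tau>))) \<longlongrightarrow>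
        integral {\<tau>..t} (\<lambda>\<sigma>. aug p \<sigma> i * ct_series (?c i) p \<sigma> \<tau>)) (finite_subsets_at_top UNIV)"
      by (rule integral_uniform_limit_weighted[OF piecewise_cont_aug[OF p] t _ lim])
         (auto intro!: continuous_on_sum continuous_on_mult continuous_on_const w_cont)
    have eq: "integral {\<tau>..t} (\<lambda>\<sigma>. aug p \<sigma> i * (\<Sum>s\<in>X. ?c i s * ct_w p s \<sigma> \<tau>)) =
        (\<Sum>s\<in>X. ?c i s * ct_w p (s @ [i]) t \<tau>)" if "finite X" for X
    proof -
      have "integral {\<tau>..t} (\<lambda>\<sigma>. \<Sum>s\<in>X. ?c i s * (aug p \<sigma> i * ct_w p s \<sigma> \<tau>)) =
          (\<Sum>s\<in>X. integral {\<tau>..t} (\<lambda>\<sigma>. ?c i s * (aug p \<sigma> i * ct_w p s \<sigma> \<tau>)))"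
        by (intro integral_sum that integrable_on_mult_right piecewise_cont_times_continuous_integrable
            piecewise_cont_aug p t w_cont)
      also have "\<dots> = (\<Sum>s\<in>X. ?c i s * ct_w p (s @ [i]) t \<tau>)"
        by (simp add: ct_w_snoc)
      finally show ?thesis by (simp add: sum_distrib_left mult.left_commute)
    qed
    show "((\<lambda>s. ?c i s * ct_w p (s @ [i]) t \<tau>) has_sum
        integral {\<tau>..t} (\<lambda>\<sigma>. aug p \<sigma> i * ct_series (?c i) p \<sigma> \<tau>)) UNIV"
      unfolding has_sum_def
      by (rule Lim_transform_eventually[OF tendsto eventually_finite_subsets_at_top_weakI[OF eq]])
  qed
  have "ct_series c p t \<tau> = c [] + (\<Sum>i\<in>UNIV. \<Sum>\<^sub>\<infinity>s. ?c i s * ct_w p (s @ [i]) t \<tau>)"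
    unfolding ct_series_def
    by (subst infsum_lists_snoc[OF ct_series_summable[OF p c t]]) (simp add: ct_w_Nil)
  also have "\<dots> = c [] + (\<Sum>i\<in>UNIV. integral {\<tau>..t} (\<lambda>\<sigma>. aug p \<sigma> i * ct_series (?c i) p \<sigma> \<tau>))"
    by (simp add: swap)
  also have "\<dots> = c [] + integral {\<tau>..t} (\<lambda>\<sigma>. \<Sum>i\<in>UNIV. aug p \<sigma> i * ct_series (?c i) p \<sigma> \<tau>)"
  proof -
    have "(\<lambda>\<sigma>. aug p \<sigma> i * ct_series (?c i) p \<sigma> \<tau>) integrable_on {\<tau>..t}" for i
      by (rule piecewise_cont_times_continuous_integrable[OF piecewise_cont_aug[OF p] t(1) S_cont])
    then show ?thesis by (simp add: integral_sum)
  qed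
  finally show ?thesis .
qed

section \<open>Uniqueness of the coefficients\<close>

text \<open>The expression is affine in x, and the zero set of an affine function is an affine set,
  so it contains the hull of \<open>P\<close>; the origin and the unit vectors then give the
  coefficients. The hull assumption enters here, and elsewhere only by making \<open>P\<close>
  nonempty.\<close>

lemma sum_aug_eq_0D:
  fixes P :: "(real ^ 'p::finite) set"
  assumes P: "affine hull P = UNIV"
    and a: "\<And>x. x \<in> P \<Longrightarrow> (\<Sum>i\<in>UNIV. (case i of None \<Rightarrow> 1 | Some k \<Rightarrow> x $ k) * a i) = 0"
  shows "a i = 0"
proof -
  define c where "c = (\<chi> k. a (Some k))"
  have eq: "(\<Sum>i\<in>UNIV. (case i of None \<Rightarrow> 1 | Some k \<Rightarrow> x $ k) * a i) = a None + c \<bullet> x" for x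
    by (simp add: UNIV_option_conv sum.reindex inner_vec_def c_def mult.commute)
  have "c \<bullet> x = - a None" if "x \<in> P" for x
    using a[OF that] eq[of x] by simp
  then have "affine hull P \<subseteq> {x. c \<bullet> x = - a None}"
    by (intro hull_minimal) (auto simp: affine_hyperplane)
  then have c: "c \<bullet> x = - a None" for x using P by auto
  have None: "a None = 0" using c[of 0] by simp
  have "a (Some k) = 0" for k
    using c[of "axis k 1"] None by (simp add: inner_axis c_def)
  with None show ?thesis by (cases i) auto
qed

section \<open>Dependence on the past of the scheduling signal, and splicing of signals\<close>

lemma aug_cong: "p t = q t' \<Longrightarrow> aug p t i = aug q t' i"
  by (simp add: aug_def split: option.split)

text \<open>The upper limit is a null set for the outermost integral, and the inner iterated
  integrals end no later. So p(t) may be prescribed at will.\<close>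

lemma ct_w_cong:
  assumes "\<And>\<sigma>. \<tau> \<le> \<sigma> \<Longrightarrow> \<sigma> < t \<Longrightarrow> p \<sigma> = q \<sigma>"
  shows "ct_w p s t \<tau> = ct_w q s t \<tau>"
  using assms
proof (induction s arbitrary: t rule: rev_induct)
  case Nil
  then show ?case by (simp add: ct_w_Nil)
next
  case (snoc i s)
  show ?case unfolding ct_w_snoc
  proof (rule integral_spike[of "{t}"])
    fix \<sigma> assume "\<sigma> \<in> {\<tau>..t} - {t}"
    then have "p \<sigma> = q \<sigma>" "ct_w p s \<sigma> \<tau> = ct_w q s \<sigma> \<tau>"
      using snoc by auto
    then show "aug q \<sigma> i * ct_w q s \<sigma> \<tau> = aug p \<sigma> i * ct_w p s \<sigma> \<tau>"
      by (simp add: aug_cong[of p \<sigma> q \<sigma>])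
  qed auto
qed

lemma ct_series_cong:
  assumes "\<And>\<sigma>. \<tau> \<le> \<sigma> \<Longrightarrow> \<sigma> < t \<Longrightarrow> p \<sigma> = q \<sigma>"
  shows "ct_series c p t \<tau> = ct_series c q t \<tau>"
  unfolding ct_series_def using ct_w_cong[of \<tau> t p q] assms by simp

text \<open>Differentiating the vanishing indefinite integral gives \<phi>. The ends of the interval
  are included by one-sided derivatives: \<open>ct_series_unique\<close> takes the left end,
  \<open>ct_out_unique\<close> the right end.\<close>

lemma integral_eq_0_imp_eq_0:
  fixes \<phi> :: "real \<Rightarrow> real"
  assumes "continuous_on {a..b} \<phi>" "a < b" "\<And>r. r \<in> {a..b} \<Longrightarrow> integral {a..r} \<phi> = 0" "x \<in> {a..b}"
  shows "\<phi> x = 0"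
proof (rule vector_derivative_unique_within_closed_interval[OF assms(2)])
  show "x \<in> cbox a b" using assms by simp
  show "((\<lambda>r. integral {a..r} \<phi>) has_vector_derivative \<phi> x) (at x within cbox a b)"
    using integral_has_vector_derivative[OF assms(1,4)] by simp
  have "((\<lambda>_. 0) has_vector_derivative 0) (at x within {a..b})" by simp
  then show "((\<lambda>r. integral {a..r} \<phi>) has_vector_derivative 0) (at x within cbox a b)"
    using has_vector_derivative_transform[of x "{a..b}" "\<lambda>r. integral {a..r} \<phi>" "\<lambda>_. 0" 0] assms
    by simp
qed

text \<open>At \<open>t0\<close> itself the second signal is already in force, so the value at
  \<open>t0\<close> can be prescribed while the past is kept. The restriction makes the result
  extensional, as \<open>ct_signals\<close> demands.\<close>

definition ct_splice :: "real \<Rightarrow> (real \<Rightarrow> 'a) \<Rightarrow> (real \<Rightarrow> 'a) \<Rightarrow> real \<Rightarrow> 'a" where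
  "ct_splice t0 p q = (\<lambda>t\<in>{0..}. if t < t0 then p t else q t)"

lemma ct_signals_piecewise_cont: "p \<in> ct_signals P \<Longrightarrow> piecewise_cont p"
  by (simp add: ct_signals_def)

lemma ct_signals_restrict:
  assumes "piecewise_cont p" "\<And>t. t \<ge> 0 \<Longrightarrow> p t \<in> P"
  shows "restrict p {0..} \<in> ct_signals P"
  using assms(2) piecewise_cont_cong[OF assms(1), of "restrict p {0..}"]
  by (auto simp: ct_signals_def)

lemma ct_signals_const: "x \<in> P \<Longrightarrow> (\<lambda>t\<in>{0..}. x) \<in> ct_signals P"
  by (rule ct_signals_restrict) (auto simp: piecewise_cont_const)

lemma ct_signals_splice:
  assumes "p \<in> ct_signals P" "q \<in> ct_signals P"
  shows "ct_splice t0 p q \<in> ct_signals P"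
  unfolding ct_splice_def
  by (rule ct_signals_restrict)
     (use assms in \<open>auto simp: ct_signals_def intro!: piecewise_cont_splice\<close>)

text \<open>The shifted coefficients inherit the vanishing for all p and all t; this is what lets
  the induction run with c generalized and its growth and vanishing carried along.\<close>

lemma ct_series_unique:
  fixes P :: "(real ^ 'p::finite) set"
  assumes P: "affine hull P = UNIV" and c: "geometric_growth c" and \<tau>: "0 \<le> \<tau>"
    and zero: "\<And>p t. p \<in> ct_signals P \<Longrightarrow> \<tau> \<le> t \<Longrightarrow> ct_series c p t \<tau> = 0"
  shows "c s = 0"
  using c zero
proof (induction s arbitrary: c rule: rev_induct)
  case Nil
  obtain x where "x \<in> P" using P by fastforce
  then have p: "(\<lambda>t\<in>{0..}. x) \<in> ct_signals P" by (rule ct_signals_const)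
  from ct_series_snoc[OF ct_signals_piecewise_cont[OF p] Nil(1) \<tau> order_refl] Nil(2)[OF p order_refl]
  show ?case by simp
next
  case (snoc i s)
  let ?c = "\<lambda>i s. c (s @ [i])"
  have "ct_series (?c i) p t0 \<tau> = 0" if p: "p \<in> ct_signals P" and t0: "\<tau> \<le> t0" for p t0
  proof (rule sum_aug_eq_0D[OF P, where a="\<lambda>i. ct_series (?c i) p t0 \<tau>"])
    fix x assume x: "x \<in> P"
    \<comment> \<open>Holding the signal at x from t0 on removes the jumps that p may have there and
      leaves the series at time t0 unchanged.\<close>
    define q where "q = ct_splice t0 p (\<lambda>t\<in>{0..}. x)"
    have q: "q \<in> ct_signals P"
      unfolding q_def by (intro ct_signals_splice p ct_signals_const x)
    note q_pc = ct_signals_piecewise_cont[OF q]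
    \<comment> \<open>\<open>\<psi>\<close> is the integrand of \<open>ct_series_snoc\<close> and
      may jump at t0; \<open>\<phi>\<close> has its coefficients frozen at x, is continuous, and
      equals \<open>\<psi>\<close> from t0 on.\<close>
    define \<psi> where "\<psi> \<sigma> = (\<Sum>i\<in>UNIV. aug q \<sigma> i * ct_series (?c i) q \<sigma> \<tau>)" for \<sigma>
    define \<phi> where "\<phi> \<sigma> = (\<Sum>i\<in>UNIV. (case i of None \<Rightarrow> 1 | Some k \<Rightarrow> x $ k) * ct_series (?c i) q \<sigma> \<tau>)" for \<sigma>
    have S_cont: "continuous_on {\<tau>..b} (\<lambda>\<sigma>. ct_series (?c i) q \<sigma> \<tau>)" for i b
      by (rule continuous_on_subset[OF continuous_on_time_triangle_slice(1)[OF
            ct_series_continuous[OF q_pc geometric_growth_snoc[OF snoc(2)]] \<tau>]]) auto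
    have \<psi>_int: "\<psi> integrable_on {\<tau>..b}" for b
      unfolding \<psi>_def
      by (intro integrable_sum finite piecewise_cont_times_continuous_integrable
          piecewise_cont_aug q_pc \<tau> S_cont)
    have \<psi>0: "c [] + integral {\<tau>..b} \<psi> = 0" if "\<tau> \<le> b" for b
      using ct_series_snoc[OF q_pc snoc(2) \<tau> that] snoc(3)[OF q that] by (simp add: \<psi>_def[abs_def])
    have "\<phi> t0 = 0"
    proof (rule integral_eq_0_imp_eq_0[where \<phi>=\<phi> and a=t0 and b="t0 + 1"])
      show "continuous_on {t0..t0 + 1} \<phi>"
        unfolding \<phi>_def
        by (intro continuous_on_sum continuous_on_mult continuous_on_const
            continuous_on_subset[OF S_cont[of "t0 + 1"]]) (use t0 in auto)
      show "integral {t0..r} \<phi> = 0" if r: "r \<in> {t0..t0 + 1}" for r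
      proof -
        have "q \<sigma> = x" if "t0 \<le> \<sigma>" for \<sigma>
          using that t0 \<tau> by (auto simp: q_def ct_splice_def)
        then have "integral {t0..r} \<phi> = integral {t0..r} \<psi>"
          by (intro integral_cong) (auto simp: \<phi>_def \<psi>_def aug_def)
        \<comment> \<open>The instances of \<open>\<psi>0\<close> with upper limits t0 and r are
          subtracted, which cancels \<open>c []\<close>.\<close>
        moreover have "integral {\<tau>..t0} \<psi> + integral {t0..r} \<psi> = integral {\<tau>..r} \<psi>"
          using t0 r by (intro Henstock_Kurzweil_Integration.integral_combine \<psi>_int) auto
        ultimately show ?thesis
          using \<psi>0[of t0] \<psi>0[of r] t0 r by auto
      qed
    qed auto
    moreover have "ct_series (?c i) q t0 \<tau> = ct_series (?c i) p t0 \<tau>" for i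
      by (rule ct_series_cong) (use \<tau> in \<open>auto simp: q_def ct_splice_def\<close>)
    ultimately show "(\<Sum>i\<in>UNIV. (case i of None \<Rightarrow> 1 | Some k \<Rightarrow> x $ k) * ct_series (?c i) p t0 \<tau>) = 0"
      by (simp add: \<phi>_def)
  qed
  from snoc(1)[OF geometric_growth_snoc[OF snoc(2)] this] show ?case .
qed

text \<open>One row (i, a) of the output with the factor p_i(t) taken out; \<open>c\<close> and
  \<open>d\<close> stand for the entries of \<eta> and \<theta> in that row. What remains depends on
  p only before t (\<open>ct_out_cong\<close>) and is continuous in t
  (\<open>ct_out_continuous\<close>).\<close>

definition ct_out ::
  "('p::finite option list \<Rightarrow> real) \<Rightarrow> ('p option \<Rightarrow> 'u::finite \<Rightarrow> 'p option list \<Rightarrow> real)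
    \<Rightarrow> (real \<Rightarrow> real ^ 'u) \<Rightarrow> (real \<Rightarrow> real ^ 'p) \<Rightarrow> real \<Rightarrow> real" where
  "ct_out c d u p t = ct_series c p t 0 +
    (\<Sum>j\<in>UNIV. \<Sum>b\<in>UNIV. integral {0..t} (\<lambda>\<delta>. (aug p \<delta> j * u \<delta> $ b) * ct_series (d j b) p t \<delta>))"

lemma ct_out_integrable:
  assumes "piecewise_cont u" "piecewise_cont p" "geometric_growth c"
  shows "(\<lambda>\<delta>. (aug p \<delta> j * u \<delta> $ b) * ct_series c p t \<delta>) integrable_on {0..t}"
  by (intro piecewise_cont_times_continuous_integrable piecewise_cont_mult piecewise_cont_aug
      piecewise_cont_vec_nth continuous_on_time_triangle_slice(2) ct_series_continuous assms) simp

lemma ct_out_continuous: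
  assumes "piecewise_cont u" "piecewise_cont p" "geometric_growth c" "\<And>j b. geometric_growth (d j b)"
  shows "continuous_on {0..} (ct_out c d u p)"
  unfolding ct_out_def
  by (intro continuous_on_add continuous_on_sum continuous_integral_time_triangle piecewise_cont_mult
      piecewise_cont_aug piecewise_cont_vec_nth
      continuous_on_time_triangle_slice(1) ct_series_continuous assms) simp

lemma ct_out_cong:
  assumes eq: "\<And>\<sigma>. 0 \<le> \<sigma> \<Longrightarrow> \<sigma> < t \<Longrightarrow> p \<sigma> = q \<sigma>"
  shows "ct_out c d u p t = ct_out c d u q t"
proof -
  have S: "ct_series c p t \<delta> = ct_series c q t \<delta>" if "0 \<le> \<delta>" for c \<delta>
    by (rule ct_series_cong) (use eq that in auto)
  have "integral {0..t} (\<lambda>\<delta>. (aug p \<delta> j * u \<delta> $ b) * ct_series (d j b) p t \<delta>) =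
      integral {0..t} (\<lambda>\<delta>. (aug q \<delta> j * u \<delta> $ b) * ct_series (d j b) q t \<delta>)" for j b
    \<comment> \<open>At \<delta> = t the integrand does involve p(t), but only on a null
      set.\<close>
    by (rule integral_spike[of "{t}"]) (use eq S in \<open>auto simp: aug_cong[of q _ p]\<close>)
  then show ?thesis by (simp add: ct_out_def S)
qed

lemma ct_out_diff:
  assumes "piecewise_cont u" "piecewise_cont p" "geometric_growth c" "\<And>j b. geometric_growth (d j b)"
    "geometric_growth c'" "\<And>j b. geometric_growth (d' j b)" "0 \<le> t"
  shows "ct_out (\<lambda>s. c s - c' s) (\<lambda>j b s. d j b s - d' j b s) u p t = ct_out c d u p t - ct_out c' d' u p t"
proof -
  have "integral {0..t} (\<lambda>\<delta>. (aug p \<delta> j * u \<delta> $ b) * ct_series (\<lambda>s. d j b s - d' j b s) p t \<delta>) =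
      integral {0..t} (\<lambda>\<delta>. (aug p \<delta> j * u \<delta> $ b) * ct_series (d j b) p t \<delta>) -
      integral {0..t} (\<lambda>\<delta>. (aug p \<delta> j * u \<delta> $ b) * ct_series (d' j b) p t \<delta>)" for j b
  proof (subst Henstock_Kurzweil_Integration.integral_diff[symmetric])
    show "integral {0..t} (\<lambda>\<delta>. (aug p \<delta> j * u \<delta> $ b) * ct_series (\<lambda>s. d j b s - d' j b s) p t \<delta>) =
      integral {0..t} (\<lambda>\<delta>. (aug p \<delta> j * u \<delta> $ b) * ct_series (d j b) p t \<delta> -
        (aug p \<delta> j * u \<delta> $ b) * ct_series (d' j b) p t \<delta>)"
      by (rule integral_cong) (simp add: ct_series_diff assms right_diff_distrib)
  qed (intro ct_out_integrable assms)+
  then show ?thesis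
    using assms(7) by (simp add: ct_out_def ct_series_diff[OF assms(2,3,5)] sum_subtractf)
qed

lemma ct_out_unique:
  fixes P :: "(real ^ 'p::finite) set" and d :: "'p option \<Rightarrow> 'u::finite \<Rightarrow> 'p option list \<Rightarrow> real"
  assumes P: "affine hull P = UNIV" and c: "geometric_growth c" and d: "\<And>j b. geometric_growth (d j b)"
    and zero: "\<And>u p t. u \<in> ct_signals UNIV \<Longrightarrow> p \<in> ct_signals P \<Longrightarrow> 0 \<le> t \<Longrightarrow> ct_out c d u p t = 0"
  shows "c s = 0" and "d j b s = 0"
proof -
  define u0 :: "real \<Rightarrow> real ^ 'u" where "u0 = (\<lambda>t\<in>{0..}. 0)"
  have u0: "u0 \<in> ct_signals UNIV" unfolding u0_def by (rule ct_signals_const) simp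
  have c_zero: "ct_series c p t 0 = 0" if p: "p \<in> ct_signals P" and t: "0 \<le> t" for p t
  proof -
    have "integral {0..t} (\<lambda>\<delta>. (aug p \<delta> j * u0 \<delta> $ b) * ct_series (d j b) p t \<delta>) = integral {0..t} (\<lambda>_. 0)" for j b
      by (rule integral_cong) (simp add: u0_def)
    then show ?thesis
      using zero[OF u0 p t] by (simp add: ct_out_def)
  qed
  then show "c s = 0"
    by (rule ct_series_unique[OF P c order_refl])
  have "ct_series (d j b) p t 1 = 0" if p: "p \<in> ct_signals P" and t: "1 \<le> t" for p t
  proof (rule sum_aug_eq_0D[OF P, where a="\<lambda>j. ct_series (d j b) p t 1"])
    fix x assume x: "x \<in> P"
    \<comment> \<open>From time 1 on p is untouched, so the series started at 1 is still that of p,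
      while the factors p_j(\<delta>) with \<delta> < 1 become constants.\<close>
    define q where "q = ct_splice 1 (\<lambda>t\<in>{0..}. x) p"
    have q: "q \<in> ct_signals P"
      unfolding q_def by (intro ct_signals_splice p ct_signals_const x)
    note q_pc = ct_signals_piecewise_cont[OF q]
    let ?x = "case_option 1 (($) x)"
    define \<phi> where "\<phi> \<delta> = (\<Sum>j\<in>UNIV. ?x j * ct_series (d j b) q t \<delta>)" for \<delta>
    have S_cont: "continuous_on {0..t} (ct_series (d j b) q t)" for j
      by (intro continuous_on_time_triangle_slice(2) ct_series_continuous q_pc d)
    have "\<phi> 1 = 0"
    \<comment> \<open>The coefficients of \<open>\<phi>\<close> are frozen at x, so its value at 1
      is determined from the left by continuity in the start time, although q(1) is p(1) and may
      differ from x.\<close>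
    proof (rule integral_eq_0_imp_eq_0[where \<phi>=\<phi> and a=0 and b=1])
      show "continuous_on {0..1} \<phi>"
        unfolding \<phi>_def
        by (intro continuous_on_sum continuous_on_mult continuous_on_const
            continuous_on_subset[OF S_cont]) (use t in auto)
      fix r :: real assume r: "r \<in> {0..1}"
      define u where "u = ct_splice r (\<lambda>t\<in>{0..}. axis b 1) u0"
      have u: "u \<in> ct_signals UNIV"
        unfolding u_def by (intro ct_signals_splice ct_signals_const u0) simp
      have int: "integral {0..t} (\<lambda>\<delta>. (aug q \<delta> j * u \<delta> $ b') * ct_series (d j b') q t \<delta>) =
          (if b' = b then ?x j * integral {0..r} (ct_series (d j b) q t) else 0)" for j b'
      proof -
        have "integral {0..t} (\<lambda>\<delta>. (aug q \<delta> j * u \<delta> $ b') * ct_series (d j b') q t \<delta>) =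
          integral {0..t} (\<lambda>\<delta>. if \<delta> \<in> {0..r} then (if b' = b then ?x j * ct_series (d j b) q t \<delta> else 0) else 0)"
        \<comment> \<open>The input is already switched off at r, whereas the indicator of [0, r]
          includes r. For r = 1 this is also the point where q leaves x.\<close>
        proof (rule integral_spike[of "{r}"])
          fix \<delta> assume \<delta>: "\<delta> \<in> {0..t} - {r}"
          show "(if \<delta> \<in> {0..r} then (if b' = b then ?x j * ct_series (d j b) q t \<delta> else 0) else 0) =
              (aug q \<delta> j * u \<delta> $ b') * ct_series (d j b') q t \<delta>"
          proof (cases "\<delta> < r")
            case True
            then have "q \<delta> = x" "u \<delta> = axis b 1"
              using \<delta> r by (auto simp: q_def u_def ct_splice_def)
            then show ?thesis using True \<delta> by (simp add: aug_def axis_def split: option.split)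
          next
            case False
            then show ?thesis using \<delta> by (auto simp: u_def u0_def ct_splice_def)
          qed
        qed simp
        also have "\<dots> = integral {0..r} (\<lambda>\<delta>. if b' = b then ?x j * ct_series (d j b) q t \<delta> else 0)"
          unfolding Henstock_Kurzweil_Integration.integral_restrict_Int using r t by (simp add: min_absorb2)
        also have "\<dots> = (if b' = b then ?x j * integral {0..r} (ct_series (d j b) q t) else 0)"
          by simp
        finally show ?thesis .
      qed
      have "0 = ct_out c d u q t" using zero[OF u q] t by simp
      also have "\<dots> = (\<Sum>j\<in>UNIV. ?x j * integral {0..r} (ct_series (d j b) q t))"
        using c_zero[OF q] t by (simp add: ct_out_def int)
      also have "\<dots> = integral {0..r} \<phi>"
      proof -
        have "(\<lambda>\<delta>. ?x j * ct_series (d j b) q t \<delta>) integrable_on {0..r}" for j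
          by (intro integrable_continuous_interval continuous_on_mult continuous_on_const
              continuous_on_subset[OF S_cont]) (use r t in auto)
        then show ?thesis by (simp add: \<phi>_def[abs_def] integral_sum)
      qed
      finally show "integral {0..r} \<phi> = 0" by simp
    qed auto
    moreover have "ct_series (d j b) q t 1 = ct_series (d j b) p t 1" for j
      by (rule ct_series_cong) (auto simp: q_def ct_splice_def)
    ultimately show "(\<Sum>j\<in>UNIV. ?x j * ct_series (d j b) p t 1) = 0"
      by (simp add: \<phi>_def)
  qed
  then show "d j b s = 0"
    by (rule ct_series_unique[OF P d zero_le_one])
qed

section \<open>Components of the impulse response representation\<close>

lemma aug_eq: "p t = x \<Longrightarrow> aug p t i = (case i of None \<Rightarrow> 1 | Some k \<Rightarrow> x $ k)"
  by (simp add: aug_def split: option.split)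

text \<open>Entries may lie in any normed space, so that two applications reach the entries of a
  matrix, which is a vector of rows.\<close>

lemma infsum_vec_nth:
  fixes f :: "'i \<Rightarrow> 'b::real_normed_vector ^ 'n::finite"
  assumes "\<And>a. (\<lambda>s. f s $ a) summable_on A"
  shows "f summable_on A" and "infsum f A $ a = (\<Sum>\<^sub>\<infinity>s\<in>A. f s $ a)"
proof -
  have "(f has_sum (\<chi> a. \<Sum>\<^sub>\<infinity>s\<in>A. f s $ a)) A"
    unfolding has_sum_def
    by (rule vec_tendstoI) (use has_sum_infsum[OF assms] in \<open>simp add: has_sum_def sum_component\<close>)
  then show "f summable_on A" "infsum f A $ a = (\<Sum>\<^sub>\<infinity>s\<in>A. f s $ a)"
    by (auto simp: summable_on_def infsumI)
qed

lemma has_integral_vec: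
  fixes f :: "real \<Rightarrow> real ^ 'n::finite"
  assumes "\<And>a. ((\<lambda>x. f x $ a) has_integral I a) S"
  shows "(f has_integral (\<chi> a. I a)) S"
  by (subst has_integral_componentwise_iff) (use assms in \<open>auto simp: Basis_vec_def inner_axis\<close>)

lemma exp_bounded_geometric_growth:
  assumes "exp_bounded \<theta>"
  shows "geometric_growth (\<lambda>s. \<theta> s $ r $ c)"
proof -
  obtain K R where KR: "K > 0" "R > 0" "\<And>s. norm (\<theta> s) \<le> K * R ^ length s"
    using assms by (auto simp: exp_bounded_def)
  have "\<bar>\<theta> s $ r $ c\<bar> \<le> K * R ^ length s" for s
  proof -
    have "\<bar>\<theta> s $ r $ c\<bar> \<le> norm (\<theta> s $ r)" by (rule component_le_norm_cart)
    also have "\<dots> \<le> norm (\<theta> s)" by (rule Finite_Cartesian_Product.norm_nth_le)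
    finally show ?thesis using KR(3)[of s] by simp
  qed
  then show ?thesis using KR unfolding geometric_growth_def by (meson less_imp_le)
qed

section \<open>Entries of the continuous-time output\<close>

context
  fixes \<theta> :: "'p::finite option list \<Rightarrow> ('p, 'u::finite, 'y::finite) iir_matrix"
  assumes \<theta>: "exp_bounded \<theta>"
begin

lemma ct_g_nth:
  assumes p: "piecewise_cont p" and t: "0 \<le> t"
  shows "ct_g \<theta> p t $ a = (\<Sum>i\<in>UNIV. aug p t i * ct_series (\<lambda>s. \<theta> s $ (i, a) $ Inl ()) p t 0)"
proof -
  have eq: "((aug p t i * ct_w p s t 0) *\<^sub>R eta \<theta> i s) $ a =
      aug p t i * (\<theta> s $ (i, a) $ Inl () * ct_w p s t 0)" for i s a
    by (simp add: eta_def)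
  have "(\<lambda>s. ((aug p t i * ct_w p s t 0) *\<^sub>R eta \<theta> i s) $ a) summable_on UNIV" for i a
    unfolding eq
    by (intro summable_on_cmult_right ct_series_summable exp_bounded_geometric_growth \<theta> p t order_refl)
  from infsum_vec_nth(2)[OF this]
  have "(\<Sum>\<^sub>\<infinity>s. (aug p t i * ct_w p s t 0) *\<^sub>R eta \<theta> i s) $ a =
      aug p t i * ct_series (\<lambda>s. \<theta> s $ (i, a) $ Inl ()) p t 0" for i
    by (simp only: eq infsum_cmult_right' ct_series_def)
  then show ?thesis by (simp add: ct_g_def)
qed

lemma ct_h_nth:
  assumes p: "piecewise_cont p" and t: "0 \<le> \<delta>" "\<delta> \<le> t"
  shows "ct_h \<theta> p \<delta> t $ a $ b =
    (\<Sum>i\<in>UNIV. \<Sum>j\<in>UNIV. aug p t i * aug p \<delta> j * ct_series (\<lambda>s. \<theta> s $ (i, a) $ Inr (j, b)) p t \<delta>)"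
proof -
  have eq: "((aug p t i * aug p \<delta> j * ct_w p s t \<delta>) *\<^sub>R theta \<theta> i j s) $ a $ b =
      (aug p t i * aug p \<delta> j) * (\<theta> s $ (i, a) $ Inr (j, b) * ct_w p s t \<delta>)" for i j s a b
    by (simp add: theta_def)
  have sm: "(\<lambda>s. ((aug p t i * aug p \<delta> j * ct_w p s t \<delta>) *\<^sub>R theta \<theta> i j s) $ a $ b) summable_on UNIV" for i j a b
    unfolding eq
    by (intro summable_on_cmult_right ct_series_summable exp_bounded_geometric_growth \<theta> p t)
  have "(\<Sum>\<^sub>\<infinity>s. (aug p t i * aug p \<delta> j * ct_w p s t \<delta>) *\<^sub>R theta \<theta> i j s) $ a $ b =
      aug p t i * aug p \<delta> j * ct_series (\<lambda>s. \<theta> s $ (i, a) $ Inr (j, b)) p t \<delta>" for i j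
  proof -
    have "(\<Sum>\<^sub>\<infinity>s. (aug p t i * aug p \<delta> j * ct_w p s t \<delta>) *\<^sub>R theta \<theta> i j s) $ a $ b =
        (\<Sum>\<^sub>\<infinity>s. ((aug p t i * aug p \<delta> j * ct_w p s t \<delta>) *\<^sub>R theta \<theta> i j s) $ a $ b)"
      by (simp only: infsum_vec_nth(2)[OF infsum_vec_nth(1)[OF sm]] infsum_vec_nth(2)[OF sm])
    then show ?thesis by (simp only: eq infsum_cmult_right' ct_series_def)
  qed
  then show ?thesis by (simp add: ct_h_def)
qed

text \<open>Both g and h carry p_i(t), which is constant in the integration variable and leaves the
  integral. Each output component is thus affine in p(t) with coefficients fixed by the past, the
  form to which \<open>sum_aug_eq_0D\<close> applies.\<close>

lemma ct_rhs_nth: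
  assumes u: "piecewise_cont u" and p: "piecewise_cont p" and t: "0 \<le> t"
  shows "(ct_g \<theta> p t + integral {0..t} (\<lambda>\<delta>. ct_h \<theta> p \<delta> t *v u \<delta>)) $ a =
    (\<Sum>i\<in>UNIV. aug p t i *
      ct_out (\<lambda>s. \<theta> s $ (i, a) $ Inl ()) (\<lambda>j b s. \<theta> s $ (i, a) $ Inr (j, b)) u p t)"
proof -
  let ?f = "\<lambda>a i j b \<delta>. (aug p \<delta> j * u \<delta> $ b) * ct_series (\<lambda>s. \<theta> s $ (i, a) $ Inr (j, b)) p t \<delta>"
  let ?I = "\<lambda>a. \<Sum>i\<in>UNIV. aug p t i * (\<Sum>j\<in>UNIV. \<Sum>b\<in>UNIV. integral {0..t} (?f a i j b))"
  have "((\<lambda>\<delta>. ct_h \<theta> p \<delta> t *v u \<delta>) has_integral (\<chi> a. ?I a)) {0..t}"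
  proof (rule has_integral_vec)
    fix a
    have "((\<lambda>\<delta>. \<Sum>i\<in>UNIV. aug p t i * (\<Sum>j\<in>UNIV. \<Sum>b\<in>UNIV. ?f a i j b \<delta>)) has_integral ?I a) {0..t}"
      by (intro has_integral_sum finite has_integral_mult_right integrable_integral ct_out_integrable
          u p exp_bounded_geometric_growth \<theta>)
    then show "((\<lambda>\<delta>. (ct_h \<theta> p \<delta> t *v u \<delta>) $ a) has_integral ?I a) {0..t}"
    proof (rule has_integral_eq[rotated])
      fix \<delta> assume "\<delta> \<in> {0..t}"
      then have \<delta>: "0 \<le> \<delta>" "\<delta> \<le> t" by auto
      \<comment> \<open>The matrix-vector product has its sum over b outermost; two interchanges
        bring it to the innermost place that it has in \<open>ct_out\<close>.\<close>
      have "(ct_h \<theta> p \<delta> t *v u \<delta>) $ a = (\<Sum>b\<in>UNIV. \<Sum>i\<in>UNIV. \<Sum>j\<in>UNIV. aug p t i * ?f a i j b \<delta>)"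
        by (simp add: matrix_vector_mult_def ct_h_nth[OF p \<delta>] sum_distrib_right) (simp add: mult_ac)
      also have "\<dots> = (\<Sum>i\<in>UNIV. \<Sum>b\<in>UNIV. \<Sum>j\<in>UNIV. aug p t i * ?f a i j b \<delta>)"
        by (rule sum.swap)
      also have "\<dots> = (\<Sum>i\<in>UNIV. \<Sum>j\<in>UNIV. \<Sum>b\<in>UNIV. aug p t i * ?f a i j b \<delta>)"
        by (rule sum.cong[OF refl]) (rule sum.swap)
      finally show "(\<Sum>i\<in>UNIV. aug p t i * (\<Sum>j\<in>UNIV. \<Sum>b\<in>UNIV. ?f a i j b \<delta>)) = (ct_h \<theta> p \<delta> t *v u \<delta>) $ a"
        by (simp add: sum_distrib_left)
    qed
  qed
  then show ?thesis
    by (simp add: integral_unique ct_g_nth[OF p t] ct_out_def distrib_left sum.distrib)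
qed

text \<open>Jumps can come only from the outer factors p_i(t), the rest being continuous in t. This
  is what places the values of the extension in the output space.\<close>

lemma ct_rhs_piecewise_cont:
  assumes u: "piecewise_cont u" and p: "piecewise_cont p"
  shows "piecewise_cont (\<lambda>t. ct_g \<theta> p t + integral {0..t} (\<lambda>\<delta>. ct_h \<theta> p \<delta> t *v u \<delta>))"
proof (rule piecewise_cont_vec_lambda)
  fix a
  have "piecewise_cont (\<lambda>t. \<Sum>i\<in>UNIV. aug p t i *
      ct_out (\<lambda>s. \<theta> s $ (i, a) $ Inl ()) (\<lambda>j b s. \<theta> s $ (i, a) $ Inr (j, b)) u p t)"
    by (intro piecewise_cont_sum piecewise_cont_mult piecewise_cont_aug p
        continuous_on_imp_piecewise_cont ct_out_continuous u exp_bounded_geometric_growth \<theta>)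
  then show "piecewise_cont (\<lambda>t. (ct_g \<theta> p t + integral {0..t} (\<lambda>\<delta>. ct_h \<theta> p \<delta> t *v u \<delta>)) $ a)"
    by (rule piecewise_cont_cong) (simp only: ct_rhs_nth[OF u p])
qed

end

lemma ct_iirD:
  assumes "ct_iir Q F \<theta>" "(u, p) \<in> ct_dom Q" "0 \<le> t"
  shows "F (u, p) t = ct_g \<theta> p t + integral {0..t} (\<lambda>\<delta>. ct_h \<theta> p \<delta> t *v u \<delta>)"
  using assms unfolding ct_iir_def by fast

lemma ct_iir_unique:
  fixes P :: "(real ^ 'p::finite) set" and \<theta> \<theta>' :: "'p option list \<Rightarrow> ('p, 'u::finite, 'y::finite) iir_matrix"
  assumes P: "affine hull P = UNIV" and F: "ct_iir P F \<theta>" and F': "ct_iir P F \<theta>'"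
  shows "\<theta> = \<theta>'"
proof -
  have \<theta>: "exp_bounded \<theta>" and \<theta>': "exp_bounded \<theta>'"
    using F F' by (auto simp: ct_iir_def)
  note growth = exp_bounded_geometric_growth[OF \<theta>] exp_bounded_geometric_growth[OF \<theta>']
  let ?out = "\<lambda>\<theta> i a. ct_out (\<lambda>s. \<theta> s $ (i, a) $ Inl ()) (\<lambda>j b s. \<theta> s $ (i, a) $ Inr (j, b))"
  have eq: "?out \<theta> i a u p t - ?out \<theta>' i a u p t = 0"
    if u: "u \<in> ct_signals UNIV" and p: "p \<in> ct_signals P" and t: "0 \<le> t" for i a u p t
  proof (rule sum_aug_eq_0D[OF P, where a="\<lambda>i. ?out \<theta> i a u p t - ?out \<theta>' i a u p t"])
    fix x assume x: "x \<in> P"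
    \<comment> \<open>Before t, which is all that \<open>ct_out\<close> reads, q is p; at t it takes
      the prescribed value x.\<close>
    define q where "q = ct_splice t p (\<lambda>t\<in>{0..}. x)"
    have q: "q \<in> ct_signals P"
      unfolding q_def by (intro ct_signals_splice p ct_signals_const x)
    note pc = ct_signals_piecewise_cont[OF u] ct_signals_piecewise_cont[OF q]
    have dom: "(u, q) \<in> ct_dom P" using u q by (simp add: ct_dom_def)
    have "ct_g \<theta> q t + integral {0..t} (\<lambda>\<delta>. ct_h \<theta> q \<delta> t *v u \<delta>) =
        ct_g \<theta>' q t + integral {0..t} (\<lambda>\<delta>. ct_h \<theta>' q \<delta> t *v u \<delta>)"
      by (rule trans[OF ct_iirD[OF F dom t, symmetric] ct_iirD[OF F' dom t]])
    then have "(\<Sum>i\<in>UNIV. aug q t i * ?out \<theta> i a u q t) = (\<Sum>i\<in>UNIV. aug q t i * ?out \<theta>' i a u q t)"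
      by (simp only: ct_rhs_nth[OF \<theta> pc t, symmetric] ct_rhs_nth[OF \<theta>' pc t, symmetric])
    moreover have "ct_out c d u q t = ct_out c d u p t" for c d
      by (rule ct_out_cong) (simp add: q_def ct_splice_def)
    moreover have "q t = x" using t by (simp add: q_def ct_splice_def)
    ultimately show "(\<Sum>i\<in>UNIV. (case i of None \<Rightarrow> 1 | Some k \<Rightarrow> x $ k) *
        (?out \<theta> i a u p t - ?out \<theta>' i a u p t)) = 0"
      by (simp add: aug_eq[of q t x] right_diff_distrib sum_subtractf)
  qed
  \<comment> \<open>Linearity in the coefficients turns equality of two outputs into vanishing of a
    single one, whose coefficients are the entrywise differences.\<close>
  have zero: "ct_out (\<lambda>s. \<theta> s $ (i, a) $ Inl () - \<theta>' s $ (i, a) $ Inl ())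
      (\<lambda>j b s. \<theta> s $ (i, a) $ Inr (j, b) - \<theta>' s $ (i, a) $ Inr (j, b)) u p t = 0"
    if "u \<in> ct_signals UNIV" "p \<in> ct_signals P" "0 \<le> t" for i a u p t
    using eq[OF that] that(3)
    by (subst ct_out_diff) (auto intro: ct_signals_piecewise_cont that growth)
  note entries = ct_out_unique[OF P geometric_growth_diff[OF growth] geometric_growth_diff[OF growth] zero]
  have "\<theta> s $ (i, a) $ c = \<theta>' s $ (i, a) $ c" for s i a c
  proof (cases c)
    case (Inl v)
    then show ?thesis using entries(1)[where s=s] by simp
  next
    case (Inr v)
    then show ?thesis using entries(2)[where s=s] by (cases v) simp
  qed
  then show ?thesis by (auto simp: vec_eq_iff)
qed

section \<open>Discrete time\<close>

text \<open>A word whose length does not fit the time span has weight 0, so the discrete series is a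
  finite sum over words of one length. That length is the argument \<open>n\<close>, in place of the
  final time.\<close>

definition dt_series :: "('p::finite option list \<Rightarrow> real) \<Rightarrow> (nat \<Rightarrow> real ^ 'p) \<Rightarrow> nat \<Rightarrow> nat \<Rightarrow> real" where
  "dt_series c p n \<tau> = (\<Sum>s | length s = n. c s * (\<Prod>k<n. aug p (\<tau> + k) (s ! k)))"

lemma finite_lists_length: "finite {s :: 'a::finite list. length s = n}"
  using finite_lists_length_eq[of "UNIV :: 'a set" n] by simp

text \<open>The span from \<tau> to t - 1 holds t - \<tau> letters. For \<tau> = t it is empty and
  only the empty word counts, with weight 1; the integer \<open>int t - 1\<close> covers t =
  0.\<close>

lemma infsum_dt_w:
  fixes c :: "'p::finite option list \<Rightarrow> real"
  assumes "\<tau> \<le> t"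
  shows "(\<lambda>s. c s * dt_w p s (int t - 1) (int \<tau>)) summable_on UNIV"
    and "(\<Sum>\<^sub>\<infinity>s. c s * dt_w p s (int t - 1) (int \<tau>)) = dt_series c p (t - \<tau>) \<tau>"
proof -
  let ?f = "\<lambda>s. c s * dt_w p s (int t - 1) (int \<tau>)"
  have w: "dt_w p s (int t - 1) (int \<tau>) =
      (if length s = t - \<tau> then \<Prod>k<t - \<tau>. aug p (\<tau> + k) (s ! k) else 0)" for s
  proof -
    have "int (length s) = int t - 1 - int \<tau> + 1 \<longleftrightarrow> length s = t - \<tau>"
      using assms by linarith
    moreover have "nat (int \<tau> + int k) = \<tau> + k" for k by linarith
    ultimately show ?thesis by (simp add: dt_w_def)
  qed
  have "(?f has_sum dt_series c p (t - \<tau>) \<tau>) {s. length s = t - \<tau>}"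
    by (rule has_sum_finiteI) (auto simp: finite_lists_length dt_series_def w)
  then have "(?f has_sum dt_series c p (t - \<tau>) \<tau>) UNIV"
    by (rule has_sum_cong_neutral[THEN iffD1, rotated -1]) (auto simp: w)
  then show "?f summable_on UNIV" "(\<Sum>\<^sub>\<infinity>s. ?f s) = dt_series c p (t - \<tau>) \<tau>"
    by (auto simp: summable_on_def infsumI)
qed

lemma dt_series_cong:
  assumes "\<And>\<sigma>. \<tau> \<le> \<sigma> \<Longrightarrow> \<sigma> < \<tau> + n \<Longrightarrow> p \<sigma> = q \<sigma>"
  shows "dt_series c p n \<tau> = dt_series c q n \<tau>"
  unfolding dt_series_def
  by (intro sum.cong prod.cong refl arg_cong2[where f="(*)"] aug_cong assms) auto

lemma dt_series_diff:
  "dt_series (\<lambda>s. c s - d s) p n \<tau> = dt_series c p n \<tau> - dt_series d p n \<tau>"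
  by (simp add: dt_series_def left_diff_distrib sum_subtractf)

text \<open>The first letter is paired with the earliest time \<tau>, so splitting it off moves the
  start to \<open>Suc \<tau>\<close> and suits ordinary list induction.\<close>

lemma dt_series_Suc:
  "dt_series c p (Suc n) \<tau> = (\<Sum>i\<in>UNIV. aug p \<tau> i * dt_series (\<lambda>s. c (i # s)) p n (Suc \<tau>))"
proof -
  let ?h = "\<lambda>(i, s :: 'a option list). i # s"
  have "dt_series c p (Suc n) \<tau> =
      (\<Sum>x\<in>UNIV \<times> {s. length s = n}. c (?h x) * (\<Prod>k<Suc n. aug p (\<tau> + k) (?h x ! k)))"
    unfolding dt_series_def
    by (rule sum.reindex_bij_betw[symmetric], rule bij_betw_byWitness[where f'="\<lambda>s. (hd s, tl s)"])
       (auto simp: length_Suc_conv)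
  also have "\<dots> = (\<Sum>i\<in>UNIV. \<Sum>s | length s = n. aug p \<tau> i * (c (i # s) * (\<Prod>k<n. aug p (Suc \<tau> + k) (s ! k))))"
    by (simp add: sum.cartesian_product case_prod_beta' prod.lessThan_Suc_shift mult_ac del: prod.lessThan_Suc)
  finally show ?thesis by (simp add: dt_series_def sum_distrib_left)
qed

lemma dt_signals_upd: "p \<in> dt_signals P \<Longrightarrow> x \<in> P \<Longrightarrow> p(t := x) \<in> dt_signals P"
  by (auto simp: dt_signals_def)

text \<open>Changing p at \<tau> leaves the products from \<open>Suc \<tau>\<close> on intact, so
  the first letter separates at once, where continuous time needs a derivative. The start time moves
  at each step and is generalized together with c.\<close>

lemma dt_series_unique:
  fixes P :: "(real ^ 'p::finite) set"
  assumes P: "affine hull P = UNIV"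
    and zero: "\<And>p. p \<in> dt_signals P \<Longrightarrow> dt_series c p (length s) \<tau> = 0"
  shows "c s = 0"
  using zero
proof (induction s arbitrary: c \<tau>)
  case Nil
  obtain x where "x \<in> P" using P by fastforce
  then have "(\<lambda>_. x) \<in> dt_signals P" by (simp add: dt_signals_def)
  from Nil[OF this] show ?case by (simp add: dt_series_def)
next
  case (Cons i s)
  have "dt_series (\<lambda>s. c (i # s)) p (length s) (Suc \<tau>) = 0" if p: "p \<in> dt_signals P" for p
  proof (rule sum_aug_eq_0D[OF P, where a="\<lambda>i. dt_series (\<lambda>s. c (i # s)) p (length s) (Suc \<tau>)"])
    fix x assume x: "x \<in> P"
    define q where "q = p(\<tau> := x)"
    have "dt_series c' q (length s) (Suc \<tau>) = dt_series c' p (length s) (Suc \<tau>)" for c'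
      by (rule dt_series_cong) (simp add: q_def)
    moreover have "q \<in> dt_signals P" "q \<tau> = x"
      unfolding q_def using dt_signals_upd[OF p x] by auto
    ultimately show "(\<Sum>i\<in>UNIV. (case i of None \<Rightarrow> 1 | Some k \<Rightarrow> x $ k) *
        dt_series (\<lambda>s. c (i # s)) p (length s) (Suc \<tau>)) = 0"
      using Cons(2)[of q] by (simp add: dt_series_Suc aug_eq[of q \<tau> x])
  qed
  then show ?case by (rule Cons(1))
qed

text \<open>As in \<open>ct_out\<close>, the factor p_i(t) is taken out. Between input and output
  lie the times \<open>Suc \<delta>\<close> to t - 1, hence \<open>t - Suc \<delta>\<close>
  letters.\<close>

definition dt_out ::
  "('p::finite option list \<Rightarrow> real) \<Rightarrow> ('p option \<Rightarrow> 'u::finite \<Rightarrow> 'p option list \<Rightarrow> real)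
    \<Rightarrow> (nat \<Rightarrow> real ^ 'u) \<Rightarrow> (nat \<Rightarrow> real ^ 'p) \<Rightarrow> nat \<Rightarrow> real" where
  "dt_out c d u p t = dt_series c p t 0 +
    (\<Sum>\<delta><t. \<Sum>j\<in>UNIV. \<Sum>b\<in>UNIV. aug p \<delta> j * u \<delta> $ b * dt_series (d j b) p (t - Suc \<delta>) (Suc \<delta>))"

lemma dt_out_cong:
  assumes eq: "\<And>\<sigma>. \<sigma> < t \<Longrightarrow> p \<sigma> = q \<sigma>"
  shows "dt_out c d u p t = dt_out c d u q t"
  unfolding dt_out_def
  by (intro arg_cong2[where f="(+)"] arg_cong2[where f="(*)"] sum.cong refl dt_series_cong aug_cong eq) auto

lemma dt_out_diff:
  "dt_out (\<lambda>s. c s - c' s) (\<lambda>j b s. d j b s - d' j b s) u p t = dt_out c d u p t - dt_out c' d' u p t"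
  by (simp add: dt_out_def dt_series_diff right_diff_distrib sum_subtractf)

lemma dt_out_unique:
  fixes P :: "(real ^ 'p::finite) set" and d :: "'p option \<Rightarrow> 'u::finite \<Rightarrow> 'p option list \<Rightarrow> real"
  assumes P: "affine hull P = UNIV"
    and zero: "\<And>u p t. p \<in> dt_signals P \<Longrightarrow> dt_out c d u p t = 0"
  shows "c s = 0" and "d j b s = 0"
proof -
  have c_zero: "dt_series c p t 0 = 0" if "p \<in> dt_signals P" for p t
    using zero[OF that, of "\<lambda>_. 0"] by (simp add: dt_out_def)
  then show "c s = 0" by (rule dt_series_unique[OF P])
  have "dt_series (d j b) p (length s) 1 = 0" if p: "p \<in> dt_signals P" for p
  proof (rule sum_aug_eq_0D[OF P, where a="\<lambda>j. dt_series (d j b) p (length s) 1"])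
    fix x assume x: "x \<in> P"
    let ?q = "p(0 := x)" and ?n = "length s"
    \<comment> \<open>A unit impulse at time 0 leaves only \<delta> = 0 in the sum. At output time
      \<open>Suc ?n\<close> exactly \<open>?n\<close> letters lie in between, at times 1 to
      \<open>?n\<close>, so the value of p at time 0 can be set to x without touching them.\<close>
    let ?u = "\<lambda>\<delta>. if \<delta> = (0::nat) then axis b 1 else 0"
    have q: "?q \<in> dt_signals P" by (rule dt_signals_upd[OF p x])
    have "0 = dt_out c d ?u ?q (Suc ?n)" using zero[OF q] by simp
    also have "\<dots> = (\<Sum>j\<in>UNIV. \<Sum>b'\<in>UNIV. aug ?q 0 j * axis b 1 $ b' * dt_series (d j b') ?q ?n 1)"
      by (simp add: dt_out_def c_zero[OF q] sum.lessThan_Suc_shift del: sum.lessThan_Suc)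
    also have "\<dots> = (\<Sum>j\<in>UNIV. aug ?q 0 j * dt_series (d j b) ?q ?n 1)"
      by (simp add: axis_def if_distrib if_distribR cong: if_cong)
    finally show "(\<Sum>j\<in>UNIV. (case j of None \<Rightarrow> 1 | Some k \<Rightarrow> x $ k) * dt_series (d j b) p ?n 1) = 0"
      using dt_series_cong[of 1 ?n ?q p] by (simp add: aug_eq[of ?q 0 x])
  qed
  then show "d j b s = 0" by (rule dt_series_unique[OF P])
qed

section \<open>Entries of the discrete-time output\<close>

lemma dt_g_nth:
  "dt_g \<theta> p t $ a = (\<Sum>i\<in>UNIV. aug p t i * dt_series (\<lambda>s. \<theta> s $ (i, a) $ Inl ()) p t 0)"
proof -
  have eq: "((aug p t i * dt_w p s (int t - 1) 0) *\<^sub>R eta \<theta> i s) $ a =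
      aug p t i * (\<theta> s $ (i, a) $ Inl () * dt_w p s (int t - 1) (int 0))" for i s a
    by (simp add: eta_def)
  have "(\<lambda>s. ((aug p t i * dt_w p s (int t - 1) 0) *\<^sub>R eta \<theta> i s) $ a) summable_on UNIV" for i a
    unfolding eq by (intro summable_on_cmult_right infsum_dt_w) simp
  from infsum_vec_nth(2)[OF this]
  have "(\<Sum>\<^sub>\<infinity>s. (aug p t i * dt_w p s (int t - 1) 0) *\<^sub>R eta \<theta> i s) $ a =
      aug p t i * dt_series (\<lambda>s. \<theta> s $ (i, a) $ Inl ()) p t 0" for i
    by (simp only: eq infsum_cmult_right' infsum_dt_w le0 diff_zero)
  then show ?thesis by (simp add: dt_g_def)
qed

lemma dt_h_nth:
  assumes t: "\<delta> < t"
  shows "dt_h \<theta> p \<delta> t $ a $ b = (\<Sum>i\<in>UNIV. \<Sum>j\<in>UNIV. aug p t i * aug p \<delta> j *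
    dt_series (\<lambda>s. \<theta> s $ (i, a) $ Inr (j, b)) p (t - Suc \<delta>) (Suc \<delta>))"
proof -
  let ?M = "\<lambda>i j s. (aug p t i * aug p \<delta> j * dt_w p s (int t - 1) (int \<delta> + 1)) *\<^sub>R theta \<theta> i j s"
  have eq: "?M i j s $ a $ b = (aug p t i * aug p \<delta> j) *
      (\<theta> s $ (i, a) $ Inr (j, b) * dt_w p s (int t - 1) (int (Suc \<delta>)))" for i j s a b
    by (simp add: theta_def add.commute)
  have sm: "(\<lambda>s. ?M i j s $ a $ b) summable_on UNIV" for i j a b
    unfolding eq using t by (intro summable_on_cmult_right infsum_dt_w) simp
  have "(\<Sum>\<^sub>\<infinity>s. ?M i j s) $ a $ b = aug p t i * aug p \<delta> j *
      dt_series (\<lambda>s. \<theta> s $ (i, a) $ Inr (j, b)) p (t - Suc \<delta>) (Suc \<delta>)" for i j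
  proof -
    have "(\<Sum>\<^sub>\<infinity>s. ?M i j s) $ a $ b = (\<Sum>\<^sub>\<infinity>s. ?M i j s $ a $ b)"
      by (simp only: infsum_vec_nth(2)[OF infsum_vec_nth(1)[OF sm]] infsum_vec_nth(2)[OF sm])
    then show ?thesis using t by (simp only: eq infsum_cmult_right' infsum_dt_w Suc_leI)
  qed
  then show ?thesis by (simp add: dt_h_def)
qed

lemma dt_rhs_nth:
  "(dt_g \<theta> p t + (\<Sum>\<delta><t. dt_h \<theta> p \<delta> t *v u \<delta>)) $ a =
    (\<Sum>i\<in>UNIV. aug p t i *
      dt_out (\<lambda>s. \<theta> s $ (i, a) $ Inl ()) (\<lambda>j b s. \<theta> s $ (i, a) $ Inr (j, b)) u p t)"
proof -
  let ?f = "\<lambda>i j b \<delta>. aug p \<delta> j * u \<delta> $ b *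
    dt_series (\<lambda>s. \<theta> s $ (i, a) $ Inr (j, b)) p (t - Suc \<delta>) (Suc \<delta>)"
  have "(dt_h \<theta> p \<delta> t *v u \<delta>) $ a = (\<Sum>i\<in>UNIV. aug p t i * (\<Sum>j\<in>UNIV. \<Sum>b\<in>UNIV. ?f i j b \<delta>))"
    if "\<delta> < t" for \<delta>
  proof -
    have "(dt_h \<theta> p \<delta> t *v u \<delta>) $ a = (\<Sum>b\<in>UNIV. \<Sum>i\<in>UNIV. \<Sum>j\<in>UNIV. aug p t i * ?f i j b \<delta>)"
      by (simp add: matrix_vector_mult_def dt_h_nth[OF that] sum_distrib_right) (simp add: mult_ac)
    also have "\<dots> = (\<Sum>i\<in>UNIV. \<Sum>b\<in>UNIV. \<Sum>j\<in>UNIV. aug p t i * ?f i j b \<delta>)"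
      by (rule sum.swap)
    also have "\<dots> = (\<Sum>i\<in>UNIV. \<Sum>j\<in>UNIV. \<Sum>b\<in>UNIV. aug p t i * ?f i j b \<delta>)"
      by (rule sum.cong[OF refl]) (rule sum.swap)
    finally show ?thesis by (simp add: sum_distrib_left)
  qed
  then have "(\<Sum>\<delta><t. (dt_h \<theta> p \<delta> t *v u \<delta>) $ a) =
      (\<Sum>\<delta><t. \<Sum>i\<in>UNIV. aug p t i * (\<Sum>j\<in>UNIV. \<Sum>b\<in>UNIV. ?f i j b \<delta>))"
    by simp
  also have "\<dots> = (\<Sum>i\<in>UNIV. aug p t i * (\<Sum>\<delta><t. \<Sum>j\<in>UNIV. \<Sum>b\<in>UNIV. ?f i j b \<delta>))"
    by (subst sum.swap) (simp only: sum_distrib_left)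
  finally show ?thesis
    by (simp add: dt_g_nth dt_out_def distrib_left sum.distrib)
qed

lemma dt_iirD:
  assumes "dt_iir Q F \<theta>" "(u, p) \<in> dt_dom Q"
  shows "F (u, p) t = dt_g \<theta> p t + (\<Sum>\<delta><t. dt_h \<theta> p \<delta> t *v u \<delta>)"
  using assms unfolding dt_iir_def by fast

lemma dt_iir_unique:
  fixes P :: "(real ^ 'p::finite) set" and \<theta> \<theta>' :: "'p option list \<Rightarrow> ('p, 'u::finite, 'y::finite) iir_matrix"
  assumes P: "affine hull P = UNIV" and F: "dt_iir P F \<theta>" and F': "dt_iir P F \<theta>'"
  shows "\<theta> = \<theta>'"
proof -
  let ?out = "\<lambda>\<theta> i a. dt_out (\<lambda>s. \<theta> s $ (i, a) $ Inl ()) (\<lambda>j b s. \<theta> s $ (i, a) $ Inr (j, b))"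
  have "?out \<theta> i a u p t - ?out \<theta>' i a u p t = 0" if p: "p \<in> dt_signals P" for i a u p t
  proof (rule sum_aug_eq_0D[OF P, where a="\<lambda>i. ?out \<theta> i a u p t - ?out \<theta>' i a u p t"])
    fix x assume x: "x \<in> P"
    let ?q = "p(t := x)"
    have dom: "(u, ?q) \<in> dt_dom P" using dt_signals_upd[OF p x] by (simp add: dt_dom_def dt_signals_def)
    have "dt_g \<theta> ?q t + (\<Sum>\<delta><t. dt_h \<theta> ?q \<delta> t *v u \<delta>) =
        dt_g \<theta>' ?q t + (\<Sum>\<delta><t. dt_h \<theta>' ?q \<delta> t *v u \<delta>)"
      by (rule trans[OF dt_iirD[OF F dom, symmetric] dt_iirD[OF F' dom]])
    then have "(\<Sum>i\<in>UNIV. aug ?q t i * ?out \<theta> i a u ?q t) = (\<Sum>i\<in>UNIV. aug ?q t i * ?out \<theta>' i a u ?q t)"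
      by (simp only: dt_rhs_nth[symmetric])
    moreover have "dt_out c d u ?q t = dt_out c d u p t" for c d
      by (rule dt_out_cong) simp
    ultimately show "(\<Sum>i\<in>UNIV. (case i of None \<Rightarrow> 1 | Some k \<Rightarrow> x $ k) *
        (?out \<theta> i a u p t - ?out \<theta>' i a u p t)) = 0"
      by (simp add: aug_eq[of ?q t x] right_diff_distrib sum_subtractf)
  qed
  then have zero: "dt_out (\<lambda>s. \<theta> s $ (i, a) $ Inl () - \<theta>' s $ (i, a) $ Inl ())
      (\<lambda>j b s. \<theta> s $ (i, a) $ Inr (j, b) - \<theta>' s $ (i, a) $ Inr (j, b)) u p t = 0"
    if "p \<in> dt_signals P" for i a u p t
    using that by (simp add: dt_out_diff)
  note entries = dt_out_unique[OF P zero]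
  have "\<theta> s $ (i, a) $ c = \<theta>' s $ (i, a) $ c" for s i a c
  proof (cases c)
    case (Inl v)
    then show ?thesis using entries(1)[where s=s] by simp
  next
    case (Inr v)
    then show ?thesis using entries(2)[where s=s] by (cases v) simp
  qed
  then show ?thesis by (auto simp: vec_eq_iff)
qed

section \<open>Extension of the input-output function\<close>

text \<open>Both time models share this argument, hence the abstraction over \<open>io\<close>,
  \<open>iir\<close> and \<open>D\<close>. \<open>det\<close> is used on \<open>P\<close>, to
  identify the restriction of the constructed extension with F and to compare F with F', and on
  \<open>UNIV\<close>, to compare two extensions.\<close>

lemma representation_unique_extension:
  assumes det: "\<And>Q F F' \<theta>. F \<in> io Q \<Longrightarrow> F' \<in> io Q \<Longrightarrow> iir Q F \<theta> \<Longrightarrow> iir Q F' \<theta> \<Longrightarrow> F = F'"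
    and uniq: "\<And>F \<theta> \<theta>'. iir P F \<theta> \<Longrightarrow> iir P F \<theta>' \<Longrightarrow> \<theta> = \<theta>'"
    and ext: "\<And>F \<theta>. iir P F \<theta> \<Longrightarrow> \<exists>Fe \<in> io UNIV. iir UNIV Fe \<theta>"
    and restr: "\<And>Fe \<theta>. Fe \<in> io UNIV \<Longrightarrow> iir UNIV Fe \<theta> \<Longrightarrow>
      restrict Fe (D P) \<in> io P \<and> iir P (restrict Fe (D P)) \<theta>"
  shows "\<forall>F \<theta>. F \<in> io P \<and> iir P F \<theta> \<longrightarrow>
    (\<forall>F' \<theta>'. F' \<in> io P \<and> iir P F' \<theta>' \<longrightarrow> (F = F' \<longleftrightarrow> \<theta> = \<theta>')) \<and>
    (\<exists>!Fe. Fe \<in> io UNIV \<and> restrict Fe (D P) = F \<and> (\<exists>\<theta>e. iir UNIV Fe \<theta>e)) \<and>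
    (\<forall>Fe. Fe \<in> io UNIV \<and> restrict Fe (D P) = F \<and> (\<exists>\<theta>e. iir UNIV Fe \<theta>e) \<longrightarrow>
      (\<forall>\<theta>e. iir UNIV Fe \<theta>e \<longleftrightarrow> \<theta>e = \<theta>))"
proof (intro allI impI)
  fix F \<theta> assume F: "F \<in> io P \<and> iir P F \<theta>"
  \<comment> \<open>Restriction to the original domain keeps \<open>\<theta>e\<close>, so uniqueness
    over \<open>P\<close> decides.\<close>
  have \<theta>e: "\<theta>e = \<theta>" if "Fe \<in> io UNIV" "restrict Fe (D P) = F" "iir UNIV Fe \<theta>e" for Fe \<theta>e
    using restr[OF that(1,3)] that(2) F uniq by blast
  obtain Fe where Fe: "Fe \<in> io UNIV" "iir UNIV Fe \<theta>" using ext F by blast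
  have "restrict Fe (D P) = F" using restr[OF Fe] F det by blast
  with Fe have "\<exists>!Fe. Fe \<in> io UNIV \<and> restrict Fe (D P) = F \<and> (\<exists>\<theta>e. iir UNIV Fe \<theta>e)"
    using \<theta>e det[of _ UNIV] by (metis (no_types, lifting))
  then show "(\<forall>F' \<theta>'. F' \<in> io P \<and> iir P F' \<theta>' \<longrightarrow> (F = F' \<longleftrightarrow> \<theta> = \<theta>')) \<and>
    (\<exists>!Fe. Fe \<in> io UNIV \<and> restrict Fe (D P) = F \<and> (\<exists>\<theta>e. iir UNIV Fe \<theta>e)) \<and>
    (\<forall>Fe. Fe \<in> io UNIV \<and> restrict Fe (D P) = F \<and> (\<exists>\<theta>e. iir UNIV Fe \<theta>e) \<longrightarrow>
      (\<forall>\<theta>e. iir UNIV Fe \<theta>e \<longleftrightarrow> \<theta>e = \<theta>))"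
    using F det[of _ P] uniq \<theta>e by (intro conjI) (blast, assumption, blast)
qed

section \<open>Equality, extension and restriction in continuous time\<close>

lemma ct_io_eqI:
  fixes F F' :: "(real \<Rightarrow> real ^ 'u::finite) \<times> (real \<Rightarrow> real ^ 'p::finite) \<Rightarrow> real \<Rightarrow> real ^ 'y::finite"
  assumes "F \<in> ct_io Q" "F' \<in> ct_io Q" "ct_iir Q F \<theta>" "ct_iir Q F' \<theta>"
  shows "F = F'"
proof (rule PiE_ext[OF assms(1,2)[unfolded ct_io_def]])
  fix x :: "(real \<Rightarrow> real ^ 'u) \<times> (real \<Rightarrow> real ^ 'p)" assume x: "x \<in> ct_dom Q"
  have "F x \<in> ct_signals UNIV" "F' x \<in> ct_signals UNIV"
    using assms(1,2) x by (auto simp: ct_io_def)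
  \<comment> \<open>The representation speaks of t \<ge> 0 only; agreement at negative times comes
    from extensionality of the output signals.\<close>
  then have "F x \<in> {0..} \<rightarrow>\<^sub>E UNIV" "F' x \<in> {0..} \<rightarrow>\<^sub>E UNIV"
    by (auto simp: ct_signals_def)
  then show "F x = F' x"
    by (rule PiE_ext) (use x in \<open>cases x; simp add: ct_iirD[OF assms(3)] ct_iirD[OF assms(4)]\<close>)
qed

lemma ct_extension_exists:
  assumes "ct_iir P F \<theta>"
  shows "\<exists>F \<in> ct_io UNIV. ct_iir UNIV F \<theta>"
proof
  let ?F = "\<lambda>x\<in>ct_dom UNIV. \<lambda>t\<in>{0..}.
    ct_g \<theta> (snd x) t + integral {0..t} (\<lambda>\<delta>. ct_h \<theta> (snd x) \<delta> t *v fst x \<delta>)"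
  have \<theta>: "exp_bounded \<theta>" using assms by (simp add: ct_iir_def)
  then show "?F \<in> ct_io UNIV"
    by (auto simp: ct_io_def ct_dom_def intro!: ct_signals_restrict ct_rhs_piecewise_cont
        dest: ct_signals_piecewise_cont)
  show "ct_iir UNIV ?F \<theta>" using \<theta> by (auto simp: ct_iir_def)
qed

lemma ct_dom_mono: "ct_dom P \<subseteq> ct_dom UNIV"
  by (auto simp: ct_dom_def ct_signals_def)

lemma ct_restrict:
  assumes "F \<in> ct_io UNIV" "ct_iir UNIV F \<theta>"
  shows "restrict F (ct_dom P) \<in> ct_io P \<and> ct_iir P (restrict F (ct_dom P)) \<theta>"
  using assms ct_dom_mono[of P] by (fastforce simp: ct_io_def ct_iir_def)

section \<open>Equality, extension and restriction in discrete time\<close>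

lemma dt_io_eqI:
  fixes F F' :: "(nat \<Rightarrow> real ^ 'u::finite) \<times> (nat \<Rightarrow> real ^ 'p::finite) \<Rightarrow> nat \<Rightarrow> real ^ 'y::finite"
  assumes "F \<in> dt_io Q" "F' \<in> dt_io Q" "dt_iir Q F \<theta>" "dt_iir Q F' \<theta>"
  shows "F = F'"
proof (rule PiE_ext[OF assms(1,2)[unfolded dt_io_def]])
  fix x :: "(nat \<Rightarrow> real ^ 'u) \<times> (nat \<Rightarrow> real ^ 'p)" assume "x \<in> dt_dom Q"
  then show "F x = F' x"
    by (cases x) (simp add: fun_eq_iff dt_iirD[OF assms(3)] dt_iirD[OF assms(4)])
qed

lemma dt_extension_exists:
  assumes "dt_iir P F \<theta>"
  shows "\<exists>F \<in> dt_io UNIV. dt_iir UNIV F \<theta>"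
proof
  let ?F = "\<lambda>x\<in>dt_dom UNIV. \<lambda>t. dt_g \<theta> (snd x) t + (\<Sum>\<delta><t. dt_h \<theta> (snd x) \<delta> t *v fst x \<delta>)"
  show "?F \<in> dt_io UNIV" by (auto simp: dt_io_def dt_signals_def)
  show "dt_iir UNIV ?F \<theta>" using assms by (auto simp: dt_iir_def)
qed

lemma dt_dom_mono: "dt_dom P \<subseteq> dt_dom UNIV"
  by (auto simp: dt_dom_def dt_signals_def)

lemma dt_restrict:
  assumes "F \<in> dt_io UNIV" "dt_iir UNIV F \<theta>"
  shows "restrict F (dt_dom P) \<in> dt_io P \<and> dt_iir P (restrict F (dt_dom P)) \<theta>"
  using assms dt_dom_mono[of P] by (fastforce simp: dt_io_def dt_iir_def)

theorem lemma2:
  fixes P :: "(real ^ 'p::finite) set"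
  assumes "affine hull P = UNIV"
  shows
    "(\<forall>(F :: (real \<Rightarrow> real ^ 'u::finite) \<times> (real \<Rightarrow> real ^ 'p) \<Rightarrow> real \<Rightarrow> real ^ 'y::finite) \<theta>.
        F \<in> ct_io P \<and> ct_iir P F \<theta> \<longrightarrow>
          (\<forall>F' \<theta>'. F' \<in> ct_io P \<and> ct_iir P F' \<theta>' \<longrightarrow> (F = F' \<longleftrightarrow> \<theta> = \<theta>')) \<and>
          (\<exists>!Fe. Fe \<in> ct_io UNIV \<and> restrict Fe (ct_dom P) = F \<and> (\<exists>\<theta>e. ct_iir UNIV Fe \<theta>e)) \<and>
          (\<forall>Fe. Fe \<in> ct_io UNIV \<and> restrict Fe (ct_dom P) = F \<and> (\<exists>\<theta>e. ct_iir UNIV Fe \<theta>e) \<longrightarrow>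
             (\<forall>\<theta>e. ct_iir UNIV Fe \<theta>e \<longleftrightarrow> \<theta>e = \<theta>))) \<and>
     (\<forall>(F :: (nat \<Rightarrow> real ^ 'u) \<times> (nat \<Rightarrow> real ^ 'p) \<Rightarrow> nat \<Rightarrow> real ^ 'y) \<theta>.
        F \<in> dt_io P \<and> dt_iir P F \<theta> \<longrightarrow>
          (\<forall>F' \<theta>'. F' \<in> dt_io P \<and> dt_iir P F' \<theta>' \<longrightarrow> (F = F' \<longleftrightarrow> \<theta> = \<theta>')) \<and>
          (\<exists>!Fe. Fe \<in> dt_io UNIV \<and> restrict Fe (dt_dom P) = F \<and> (\<exists>\<theta>e. dt_iir UNIV Fe \<theta>e)) \<and>
          (\<forall>Fe. Fe \<in> dt_io UNIV \<and> restrict Fe (dt_dom P) = F \<and> (\<exists>\<theta>e. dt_iir UNIV Fe \<theta>e) \<longrightarrow>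
             (\<forall>\<theta>e. dt_iir UNIV Fe \<theta>e \<longleftrightarrow> \<theta>e = \<theta>)))"
proof
  show "\<forall>(F :: (real \<Rightarrow> real ^ 'u) \<times> (real \<Rightarrow> real ^ 'p) \<Rightarrow> real \<Rightarrow> real ^ 'y) \<theta>.
        F \<in> ct_io P \<and> ct_iir P F \<theta> \<longrightarrow>
          (\<forall>F' \<theta>'. F' \<in> ct_io P \<and> ct_iir P F' \<theta>' \<longrightarrow> (F = F' \<longleftrightarrow> \<theta> = \<theta>')) \<and>
          (\<exists>!Fe. Fe \<in> ct_io UNIV \<and> restrict Fe (ct_dom P) = F \<and> (\<exists>\<theta>e. ct_iir UNIV Fe \<theta>e)) \<and>
          (\<forall>Fe. Fe \<in> ct_io UNIV \<and> restrict Fe (ct_dom P) = F \<and> (\<exists>\<theta>e. ct_iir UNIV Fe \<theta>e) \<longrightarrow>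
             (\<forall>\<theta>e. ct_iir UNIV Fe \<theta>e \<longleftrightarrow> \<theta>e = \<theta>))"
    by (rule representation_unique_extension[where io=ct_io and iir=ct_iir and D=ct_dom,
          OF ct_io_eqI ct_iir_unique[OF assms] ct_extension_exists ct_restrict])
next
  show "\<forall>(F :: (nat \<Rightarrow> real ^ 'u) \<times> (nat \<Rightarrow> real ^ 'p) \<Rightarrow> nat \<Rightarrow> real ^ 'y) \<theta>.
        F \<in> dt_io P \<and> dt_iir P F \<theta> \<longrightarrow>
          (\<forall>F' \<theta>'. F' \<in> dt_io P \<and> dt_iir P F' \<theta>' \<longrightarrow> (F = F' \<longleftrightarrow> \<theta> = \<theta>')) \<and>
          (\<exists>!Fe. Fe \<in> dt_io UNIV \<and> restrict Fe (dt_dom P) = F \<and> (\<exists>\<theta>e. dt_iir UNIV Fe \<theta>e)) \<and>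
          (\<forall>Fe. Fe \<in> dt_io UNIV \<and> restrict Fe (dt_dom P) = F \<and> (\<exists>\<theta>e. dt_iir UNIV Fe \<theta>e) \<longrightarrow>
             (\<forall>\<theta>e. dt_iir UNIV Fe \<theta>e \<longleftrightarrow> \<theta>e = \<theta>))"
    by (rule representation_unique_extension[where io=dt_io and iir=dt_iir and D=dt_dom,
          OF dt_io_eqI dt_iir_unique[OF assms] dt_extension_exists dt_restrict])
qed

end
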